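(* Let $T\in\mathcal F$ be a trigraph with no balanced skew-partition and let $X$ be a fragment of $T$. Then the block of decomposition $T_X$ has no balanced skew-partition.
   Context: Trigraphs: a finite vertex set $V(T)$ with $\theta:\binom{V(T)}{2}\to\{-1,0,1\}$; $u,v$ strongly adjacent if $\theta(uv)=1$, strongly antiadjacent if $-1$, a switchable pair if $0$; adjacent if $\theta\in\{0,1\}$, antiadjacent if $\theta\in\{-1,0\}$. Complement $\overline T$: adjacency $-\theta$; $T|X$: induced trigraph. Strongly complete/anticomplete: strongly adjacent/antiadjacent to all vertices of a set. Full realization: graph on $V(T)$ of adjacent pairs. $X$ connected: full realization of $T|X$ connected; anticonnected: complement of the graph on $X$ of strongly adjacent pairs connected; components = maximal connected subsets. Path: distinct $p_1,\dots,p_k$, consecutive adjacent, non-consecutive antiadjacent (length $k-1$, interior = inner vertices). Hole: distinct $h_1,\dots,h_k$, $k\ge4$, $h_i,h_j$ adjacent iff $|i-j|\in\{1,k-1\}$, otherwise antiadjacent (length $k$). Antipath/antihole: induced subtrigraph whose complement is a path/hole in $\overline T$. Berge: no odd hole and no odd antihole. Skew-partition: partition $(A,B)$ of $V(T)$, $A$ not connected, $B$ not anticonnected; balanced if no path of odd length $>1$ has ends in $B$ and interior in $A$, and no antipath of odd length $>1$ has ends in $A$ and interior in $B$. $\mathcal F$: with $\Sigma(T)$ the graph of switchable pairs, $T\in\mathcal F$ iff $T$ is Berge, each component of $\Sigma(T)$ has at most two edges, and each vertex $v$ of degree two in $\Sigma(T)$ with $\Sigma(T)$-neighbours $x,y$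 is either strongly complete to $V(T)\setminus\{v,x,y\}$ with $x,y$ strongly adjacent, or strongly anticomplete to $V(T)\setminus\{v,x,y\}$ with $x,y$ strongly antiadjacent. $2$-join: a partition $(X_1,X_2)$ of $V(T)$ with disjoint sets $A_1,B_1,C_1,A_2,B_2,C_2$ (a split), $X_i=A_i\cup B_i\cup C_i$, $A_1,A_2,B_1,B_2\neq\emptyset$, no switchable pair meeting both $X_1,X_2$, $A_1$ strongly complete to $A_2$, $B_1$ strongly complete to $B_2$, all other pairs between $X_1$ and $X_2$ strongly antiadjacent, $|X_i|\ge3$, and if $|A_i|=|B_i|=1$ the full realization of $T|X_i$ is not a path of length two between the vertices of $A_i$ and $B_i$. Proper: for $i=1,2$ each component of $T|X_i$ meets $A_i$ and $B_i$. A (proper) complement $2$-join of $T$ is a (proper) $2$-join of $\overline T$, with the same split. For a Berge trigraph and a proper $2$-join, all paths with one end in $A_i$, the other in $B_i$ and interior in $C_i$ ($i=1,2$) have lengths of the same parity; the $2$-join is odd or even accordingly; a complement $2$-join is odd/even if it is so as a $2$-join of $\overline T$. Fragment: $X\subseteq V(T)$ such that $(X,V(T)\setminus X)$ is a proper $2$-join or a proper complement $2$-join of $T$. Block $T_X$ (with $X=X_1$ and a split $(A_1,B_1,C_1,A_2,B_2,C_2)$ of $(X_1,X_2)$), starting from $T|X_1$ and adding new marker vertices, with all pairs not specified strongly antiadjacent: odd $2$-join: add $a,b$ with $a$ strongly complete to $A_1$, $b$ strongly complete to $B_1$, $ab$ switchable. Even $2$-join: add $a,b,c$ with $a$ strongly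 complete to $A_1$, $b$ strongly complete to $B_1$, $ac$ and $cb$ switchable pairs. Odd complement $2$-join: add $a,b$ with $a$ strongly complete to $B_1\cup C_1$, $b$ strongly complete to $A_1\cup C_1$, $ab$ switchable. Even complement $2$-join: add $a,b,c$ with $a$ strongly complete to $B_1\cup C_1$, $b$ strongly complete to $A_1\cup C_1$, $c$ strongly complete to $X_1$, $ac,cb$ switchable pairs, $ab$ strongly adjacent. *)

theory Defs
  imports Main
begin

section \<open>Trigraphs\<close>

text \<open>Only the values of \<open>theta\<close> on pairs of distinct vertices are meaningful; all adjacency
  notions below are therefore restricted to such pairs.\<close>

record 'a trigraph =
  verts :: "'a set"
  theta :: "'a \<Rightarrow> 'a \<Rightarrow> int"

definition wf_trigraph :: "'a trigraph \<Rightarrow> bool" where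
  "wf_trigraph T \<longleftrightarrow>
     finite (verts T) \<and>
     (\<forall>u\<in>verts T. \<forall>v\<in>verts T. u \<noteq> v \<longrightarrow>
        theta T u v \<in> {-1, 0, 1} \<and> theta T u v = theta T v u)"

definition strongly_adjacent :: "'a trigraph \<Rightarrow> 'a \<Rightarrow> 'a \<Rightarrow> bool" where
  "strongly_adjacent T u v \<longleftrightarrow> u \<in> verts T \<and> v \<in> verts T \<and> u \<noteq> v \<and> theta T u v = 1"

definition strongly_antiadjacent :: "'a trigraph \<Rightarrow> 'a \<Rightarrow> 'a \<Rightarrow> bool" where
  "strongly_antiadjacent T u v \<longleftrightarrow> u \<in> verts T \<and> v \<in> verts T \<and> u \<noteq> v \<and> theta T u v = -1"

definition switchable :: "'a trigraph \<Rightarrow> 'a \<Rightarrow> 'a \<Rightarrow> bool" where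
  "switchable T u v \<longleftrightarrow> u \<in> verts T \<and> v \<in> verts T \<and> u \<noteq> v \<and> theta T u v = 0"

definition adjacent :: "'a trigraph \<Rightarrow> 'a \<Rightarrow> 'a \<Rightarrow> bool" where
  "adjacent T u v \<longleftrightarrow> u \<in> verts T \<and> v \<in> verts T \<and> u \<noteq> v \<and> theta T u v \<in> {0, 1}"

definition antiadjacent :: "'a trigraph \<Rightarrow> 'a \<Rightarrow> 'a \<Rightarrow> bool" where
  "antiadjacent T u v \<longleftrightarrow> u \<in> verts T \<and> v \<in> verts T \<and> u \<noteq> v \<and> theta T u v \<in> {-1, 0}"

definition tri_complement :: "'a trigraph \<Rightarrow> 'a trigraph" where
  "tri_complement T = \<lparr>verts = verts T, theta = (\<lambda>u v. - theta T u v)\<rparr>"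

definition induced :: "'a trigraph \<Rightarrow> 'a set \<Rightarrow> 'a trigraph" where
  "induced T X = \<lparr>verts = verts T \<inter> X, theta = theta T\<rparr>"

definition strongly_complete :: "'a trigraph \<Rightarrow> 'a set \<Rightarrow> 'a set \<Rightarrow> bool" where
  "strongly_complete T X Y \<longleftrightarrow> (\<forall>u\<in>X. \<forall>v\<in>Y. strongly_adjacent T u v)"

definition strongly_anticomplete :: "'a trigraph \<Rightarrow> 'a set \<Rightarrow> 'a set \<Rightarrow> bool" where
  "strongly_anticomplete T X Y \<longleftrightarrow> (\<forall>u\<in>X. \<forall>v\<in>Y. strongly_antiadjacent T u v)"

text \<open>A graph is regarded as a trigraph without switchable pairs.\<close>

definition full_realization :: "'a trigraph \<Rightarrow> 'a trigraph" where
  "full_realization T =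
     \<lparr>verts = verts T, theta = (\<lambda>u v. if adjacent T u v then 1 else -1)\<rparr>"


section \<open>Connectivity\<close>

text \<open>In the following two definitions \<open>E\<close> is a symmetric edge relation. The empty set is
  connected.\<close>

definition graph_connected :: "('a \<Rightarrow> 'a \<Rightarrow> bool) \<Rightarrow> 'a set \<Rightarrow> bool" where
  "graph_connected E X \<longleftrightarrow>
     (\<forall>u\<in>X. \<forall>v\<in>X. (\<lambda>x y. x \<in> X \<and> y \<in> X \<and> E x y)\<^sup>*\<^sup>* u v)"

definition graph_component :: "('a \<Rightarrow> 'a \<Rightarrow> bool) \<Rightarrow> 'a set \<Rightarrow> 'a set \<Rightarrow> bool" where
  "graph_component E X C \<longleftrightarrow>
     C \<subseteq> X \<and> graph_connected E C \<and> (\<forall>D. C \<subseteq> D \<and> D \<subseteq> X \<and> graph_connected E D \<longrightarrow> D = C)"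

definition tri_connected :: "'a trigraph \<Rightarrow> 'a set \<Rightarrow> bool" where
  "tri_connected T X \<longleftrightarrow> graph_connected (adjacent T) X"

definition tri_anticonnected :: "'a trigraph \<Rightarrow> 'a set \<Rightarrow> bool" where
  "tri_anticonnected T X \<longleftrightarrow>
     graph_connected (\<lambda>u v. u \<noteq> v \<and> \<not> strongly_adjacent T u v) X"

definition tri_component :: "'a trigraph \<Rightarrow> 'a set \<Rightarrow> bool" where
  "tri_component T C \<longleftrightarrow> graph_component (adjacent T) (verts T) C"


section \<open>Paths, holes, Berge trigraphs\<close>

text \<open>Paths and holes are represented by the list of their vertices, in order. The length of a
  path \<open>p\<close> is \<open>length p - 1\<close>; that of a hole \<open>h\<close> is \<open>length h\<close>.\<close>

definition is_path :: "'a trigraph \<Rightarrow> 'a list \<Rightarrow> bool" where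
  "is_path T p \<longleftrightarrow>
     p \<noteq> [] \<and> distinct p \<and> set p \<subseteq> verts T \<and>
     (\<forall>i j. i < j \<and> j < length p \<longrightarrow>
        (if j - i = 1 then adjacent T (p ! i) (p ! j) else antiadjacent T (p ! i) (p ! j)))"

definition path_length :: "'a list \<Rightarrow> nat" where
  "path_length p = length p - 1"

definition path_interior :: "'a list \<Rightarrow> 'a set" where
  "path_interior p = set (butlast (tl p))"

text \<open>As for paths, a switchable pair may serve both as a consecutive and as a non-consecutive
  pair of a hole: being antiadjacent does not exclude being adjacent.\<close>

definition is_hole :: "'a trigraph \<Rightarrow> 'a list \<Rightarrow> bool" where
  "is_hole T h \<longleftrightarrow>
     length h \<ge> 4 \<and> distinct h \<and> set h \<subseteq> verts T \<and>
     (\<forall>i j. i < j \<and> j < length h \<longrightarrow>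
        (if j - i \<in> {1, length h - 1} then adjacent T (h ! i) (h ! j)
         else antiadjacent T (h ! i) (h ! j)))"

definition is_antipath :: "'a trigraph \<Rightarrow> 'a list \<Rightarrow> bool" where
  "is_antipath T p \<longleftrightarrow> is_path (tri_complement T) p"

definition is_antihole :: "'a trigraph \<Rightarrow> 'a list \<Rightarrow> bool" where
  "is_antihole T h \<longleftrightarrow> is_hole (tri_complement T) h"

definition berge :: "'a trigraph \<Rightarrow> bool" where
  "berge T \<longleftrightarrow>
     (\<nexists>h. is_hole T h \<and> odd (length h)) \<and> (\<nexists>h. is_antihole T h \<and> odd (length h))"


section \<open>Skew-partitions\<close>

definition skew_partition :: "'a trigraph \<Rightarrow> 'a set \<Rightarrow> 'a set \<Rightarrow> bool" where
  "skew_partition T A B \<longleftrightarrow>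
     A \<union> B = verts T \<and> A \<inter> B = {} \<and> \<not> tri_connected T A \<and> \<not> tri_anticonnected T B"

definition balanced_skew_partition :: "'a trigraph \<Rightarrow> 'a set \<Rightarrow> 'a set \<Rightarrow> bool" where
  "balanced_skew_partition T A B \<longleftrightarrow>
     skew_partition T A B \<and>
     (\<nexists>p. is_path T p \<and> odd (path_length p) \<and> path_length p > 1 \<and>
          hd p \<in> B \<and> last p \<in> B \<and> path_interior p \<subseteq> A) \<and>
     (\<nexists>p. is_antipath T p \<and> odd (path_length p) \<and> path_length p > 1 \<and>
          hd p \<in> A \<and> last p \<in> A \<and> path_interior p \<subseteq> B)"

definition has_balanced_skew_partition :: "'a trigraph \<Rightarrow> bool" where
  "has_balanced_skew_partition T \<longleftrightarrow> (\<exists>A B. balanced_skew_partition T A B)"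


section \<open>The class F\<close>

definition class_F :: "'a trigraph set" where
  "class_F = {T. wf_trigraph T \<and> berge T \<and>
     (\<forall>C. graph_component (switchable T) (verts T) C \<longrightarrow>
        card {{u, v} | u v. u \<in> C \<and> v \<in> C \<and> switchable T u v} \<le> 2) \<and>
     (\<forall>v\<in>verts T. \<forall>x y. x \<noteq> y \<and> {w. switchable T v w} = {x, y} \<longrightarrow>
        (strongly_complete T {v} (verts T - {v, x, y}) \<and> strongly_adjacent T x y) \<or>
        (strongly_anticomplete T {v} (verts T - {v, x, y}) \<and> strongly_antiadjacent T x y))}"


section \<open>2-joins\<close>

definition good_side :: "'a trigraph \<Rightarrow> 'a set \<Rightarrow> 'a set \<Rightarrow> 'a set \<Rightarrow> bool" where
  "good_side T A B C \<longleftrightarrow>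
     A \<noteq> {} \<and> B \<noteq> {} \<and> card (A \<union> B \<union> C) \<ge> 3 \<and>
     (card A = 1 \<and> card B = 1 \<longrightarrow>
        (\<nexists>p. is_path (full_realization (induced T (A \<union> B \<union> C))) p \<and>
             set p = A \<union> B \<union> C \<and> path_length p = 2 \<and> hd p \<in> A \<and> last p \<in> B))"

definition two_join ::
    "'a trigraph \<Rightarrow> 'a set \<Rightarrow> 'a set \<Rightarrow> 'a set \<Rightarrow> 'a set \<Rightarrow> 'a set \<Rightarrow> 'a set \<Rightarrow> bool" where
  "two_join T A1 B1 C1 A2 B2 C2 \<longleftrightarrow>
     (let X1 = A1 \<union> B1 \<union> C1; X2 = A2 \<union> B2 \<union> C2 in
       X1 \<union> X2 = verts T \<and> X1 \<inter> X2 = {} \<and>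
       A1 \<inter> B1 = {} \<and> A1 \<inter> C1 = {} \<and> B1 \<inter> C1 = {} \<and>
       A2 \<inter> B2 = {} \<and> A2 \<inter> C2 = {} \<and> B2 \<inter> C2 = {} \<and>
       (\<forall>u\<in>X1. \<forall>v\<in>X2. \<not> switchable T u v) \<and>
       strongly_complete T A1 A2 \<and> strongly_complete T B1 B2 \<and>
       (\<forall>u\<in>X1. \<forall>v\<in>X2. \<not> (u \<in> A1 \<and> v \<in> A2) \<and> \<not> (u \<in> B1 \<and> v \<in> B2) \<longrightarrow>
          strongly_antiadjacent T u v) \<and>
       good_side T A1 B1 C1 \<and> good_side T A2 B2 C2)"

definition proper_two_join ::
    "'a trigraph \<Rightarrow> 'a set \<Rightarrow> 'a set \<Rightarrow> 'a set \<Rightarrow> 'a set \<Rightarrow> 'a set \<Rightarrow> 'a set \<Rightarrow> bool" where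
  "proper_two_join T A1 B1 C1 A2 B2 C2 \<longleftrightarrow>
     two_join T A1 B1 C1 A2 B2 C2 \<and>
     (\<forall>D. tri_component (induced T (A1 \<union> B1 \<union> C1)) D \<longrightarrow> D \<inter> A1 \<noteq> {} \<and> D \<inter> B1 \<noteq> {}) \<and>
     (\<forall>D. tri_component (induced T (A2 \<union> B2 \<union> C2)) D \<longrightarrow> D \<inter> A2 \<noteq> {} \<and> D \<inter> B2 \<noteq> {})"

definition proper_complement_two_join ::
    "'a trigraph \<Rightarrow> 'a set \<Rightarrow> 'a set \<Rightarrow> 'a set \<Rightarrow> 'a set \<Rightarrow> 'a set \<Rightarrow> 'a set \<Rightarrow> bool" where
  "proper_complement_two_join T A1 B1 C1 A2 B2 C2 \<longleftrightarrow>
     proper_two_join (tri_complement T) A1 B1 C1 A2 B2 C2"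

definition side_path ::
    "'a trigraph \<Rightarrow> 'a set \<Rightarrow> 'a set \<Rightarrow> 'a set \<Rightarrow> 'a list \<Rightarrow> bool" where
  "side_path T A B C p \<longleftrightarrow> is_path T p \<and> hd p \<in> A \<and> last p \<in> B \<and> path_interior p \<subseteq> C"

text \<open>For a proper 2-join of a Berge trigraph exactly one of the following two properties holds;
  see \<open>proper_two_join_parity\<close> and \<open>proper_two_join_not_odd_even\<close> below.\<close>

definition odd_join ::
    "'a trigraph \<Rightarrow> 'a set \<Rightarrow> 'a set \<Rightarrow> 'a set \<Rightarrow> 'a set \<Rightarrow> 'a set \<Rightarrow> 'a set \<Rightarrow> bool" where
  "odd_join T A1 B1 C1 A2 B2 C2 \<longleftrightarrow>
     (\<forall>p. side_path T A1 B1 C1 p \<or> side_path T A2 B2 C2 p \<longrightarrow> odd (path_length p))"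

definition even_join ::
    "'a trigraph \<Rightarrow> 'a set \<Rightarrow> 'a set \<Rightarrow> 'a set \<Rightarrow> 'a set \<Rightarrow> 'a set \<Rightarrow> 'a set \<Rightarrow> bool" where
  "even_join T A1 B1 C1 A2 B2 C2 \<longleftrightarrow>
     (\<forall>p. side_path T A1 B1 C1 p \<or> side_path T A2 B2 C2 p \<longrightarrow> even (path_length p))"

definition fragment :: "'a trigraph \<Rightarrow> 'a set \<Rightarrow> bool" where
  "fragment T X \<longleftrightarrow> X \<subseteq> verts T \<and>
     (\<exists>A1 B1 C1 A2 B2 C2. X = A1 \<union> B1 \<union> C1 \<and> verts T - X = A2 \<union> B2 \<union> C2 \<and>
        (proper_two_join T A1 B1 C1 A2 B2 C2 \<or>
         proper_complement_two_join T A1 B1 C1 A2 B2 C2))"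


section \<open>Blocks of decomposition\<close>

datatype marker = Marker_a | Marker_b | Marker_c

text \<open>\<open>add_markers T X M N \<mu>\<close> is obtained from the trigraph induced on \<open>X\<close> by adding the markers
  in \<open>M\<close>. A marker \<open>m\<close> is strongly complete to \<open>N m\<close> and strongly anticomplete to the rest
  of \<open>X\<close>; adjacency between markers is given by \<open>\<mu>\<close>. The sum type makes the markers new.\<close>

definition add_markers ::
    "'a trigraph \<Rightarrow> 'a set \<Rightarrow> marker set \<Rightarrow> (marker \<Rightarrow> 'a set) \<Rightarrow> (marker \<Rightarrow> marker \<Rightarrow> int) \<Rightarrow>
     ('a + marker) trigraph" where
  "add_markers T X M N \<mu> =
     \<lparr>verts = Inl ` X \<union> Inr ` M,
      theta = (\<lambda>s t. case (s, t) of
          (Inl u, Inl v) \<Rightarrow> theta T u v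
        | (Inl u, Inr m) \<Rightarrow> (if u \<in> N m then 1 else -1)
        | (Inr m, Inl u) \<Rightarrow> (if u \<in> N m then 1 else -1)
        | (Inr m, Inr n) \<Rightarrow> \<mu> m n)\<rparr>"

definition odd_block ::
    "'a trigraph \<Rightarrow> 'a set \<Rightarrow> 'a set \<Rightarrow> 'a set \<Rightarrow> ('a + marker) trigraph" where
  "odd_block T A B C = add_markers T (A \<union> B \<union> C) {Marker_a, Marker_b}
     (\<lambda>m. case m of Marker_a \<Rightarrow> A | Marker_b \<Rightarrow> B | Marker_c \<Rightarrow> {})
     (\<lambda>m n. if {m, n} = {Marker_a, Marker_b} then 0 else -1)"

definition even_block ::
    "'a trigraph \<Rightarrow> 'a set \<Rightarrow> 'a set \<Rightarrow> 'a set \<Rightarrow> ('a + marker) trigraph" where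
  "even_block T A B C = add_markers T (A \<union> B \<union> C) {Marker_a, Marker_b, Marker_c}
     (\<lambda>m. case m of Marker_a \<Rightarrow> A | Marker_b \<Rightarrow> B | Marker_c \<Rightarrow> {})
     (\<lambda>m n. if {m, n} = {Marker_a, Marker_c} \<or> {m, n} = {Marker_c, Marker_b} then 0 else -1)"

definition odd_complement_block ::
    "'a trigraph \<Rightarrow> 'a set \<Rightarrow> 'a set \<Rightarrow> 'a set \<Rightarrow> ('a + marker) trigraph" where
  "odd_complement_block T A B C = add_markers T (A \<union> B \<union> C) {Marker_a, Marker_b}
     (\<lambda>m. case m of Marker_a \<Rightarrow> B \<union> C | Marker_b \<Rightarrow> A \<union> C | Marker_c \<Rightarrow> {})
     (\<lambda>m n. if {m, n} = {Marker_a, Marker_b} then 0 else -1)"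

definition even_complement_block ::
    "'a trigraph \<Rightarrow> 'a set \<Rightarrow> 'a set \<Rightarrow> 'a set \<Rightarrow> ('a + marker) trigraph" where
  "even_complement_block T A B C = add_markers T (A \<union> B \<union> C) {Marker_a, Marker_b, Marker_c}
     (\<lambda>m. case m of Marker_a \<Rightarrow> B \<union> C | Marker_b \<Rightarrow> A \<union> C | Marker_c \<Rightarrow> A \<union> B \<union> C)
     (\<lambda>m n. if {m, n} = {Marker_a, Marker_c} \<or> {m, n} = {Marker_c, Marker_b} then 0
            else if {m, n} = {Marker_a, Marker_b} then 1 else -1)"

text \<open>The block depends on the choice of a split of \<open>(X, verts T - X)\<close>, whence a relation.\<close>

definition is_block :: "'a trigraph \<Rightarrow> 'a set \<Rightarrow> ('a + marker) trigraph \<Rightarrow> bool" where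
  "is_block T X TX \<longleftrightarrow>
     (\<exists>A1 B1 C1 A2 B2 C2. X = A1 \<union> B1 \<union> C1 \<and> verts T - X = A2 \<union> B2 \<union> C2 \<and>
        (proper_two_join T A1 B1 C1 A2 B2 C2 \<and>
           (odd_join T A1 B1 C1 A2 B2 C2 \<and> TX = odd_block T A1 B1 C1 \<or>
            even_join T A1 B1 C1 A2 B2 C2 \<and> TX = even_block T A1 B1 C1) \<or>
         proper_complement_two_join T A1 B1 C1 A2 B2 C2 \<and>
           (odd_join (tri_complement T) A1 B1 C1 A2 B2 C2 \<and>
              TX = odd_complement_block T A1 B1 C1 \<or>
            even_join (tri_complement T) A1 B1 C1 A2 B2 C2 \<and>
              TX = even_complement_block T A1 B1 C1)))"


section \<open>The parity of a proper 2-join, and existence of blocks\<close>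

lemma adjacent_sym:
  "wf_trigraph T \<Longrightarrow> adjacent T u v \<Longrightarrow> adjacent T v u"
  unfolding wf_trigraph_def adjacent_def by metis

lemma antiadjacent_sym:
  "wf_trigraph T \<Longrightarrow> antiadjacent T u v \<Longrightarrow> antiadjacent T v u"
  unfolding wf_trigraph_def antiadjacent_def by metis

lemma path_interior_nth:
  assumes "0 < i" "i < length p - 1"
  shows "p ! i \<in> path_interior p"
proof -
  have "butlast (tl p) ! (i - 1) = p ! i"
    using assms by (simp add: nth_butlast nth_tl)
  moreover have "i - 1 < length (butlast (tl p))" using assms by simp
  ultimately show ?thesis unfolding path_interior_def by (metis nth_mem)
qed

lemma path_interior_conv:
  assumes "x \<in> path_interior p"
  shows "\<exists>i. 0 < i \<and> i < length p - 1 \<and> x = p ! i"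
proof -
  obtain j where "j < length (butlast (tl p))" "x = butlast (tl p) ! j"
    using assms unfolding path_interior_def by (metis in_set_conv_nth)
  then have "0 < Suc j" "Suc j < length p - 1" "x = p ! Suc j"
    by (auto simp: nth_butlast nth_tl)
  then show ?thesis by blast
qed

lemma side_path_exists:
  assumes wf: "wf_trigraph T" and sub: "A \<union> B \<union> C \<subseteq> verts T" and ne: "A \<noteq> {}"
    and dj: "A \<inter> B = {}"
    and comp: "\<And>D. tri_component (induced T (A \<union> B \<union> C)) D \<Longrightarrow> D \<inter> B \<noteq> {}"
  shows "\<exists>p. side_path T A B C p"
proof -
  define X where "X = A \<union> B \<union> C"
  define E where "E = adjacent (induced T X)"
  define R where "R = (\<lambda>x y. x \<in> X \<and> y \<in> X \<and> E x y)"
  have vX: "verts (induced T X) = X" using sub by (auto simp: induced_def X_def)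
  have E_iff: "E x y \<longleftrightarrow> x \<in> X \<and> y \<in> X \<and> adjacent T x y" for x y
    using sub by (auto simp: E_def adjacent_def induced_def X_def)
  have Rsym: "R x y \<Longrightarrow> R y x" for x y
    using adjacent_sym[OF wf] by (auto simp: R_def E_iff)
  have RR: "R\<^sup>*\<^sup>* x y \<Longrightarrow> R\<^sup>*\<^sup>* y x" for x y
    by (induction rule: rtranclp_induct) (auto intro: converse_rtranclp_into_rtranclp Rsym)
  obtain a where a: "a \<in> A" using ne by blast
  then have aX: "a \<in> X" by (simp add: X_def)
  define D where "D = {x. R\<^sup>*\<^sup>* a x}"
  have DX: "D \<subseteq> X"
  proof
    fix x assume "x \<in> D"
    then have "R\<^sup>*\<^sup>* a x" by (simp add: D_def)
    then show "x \<in> X" by (cases rule: rtranclp.cases) (auto simp: R_def aX)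
  qed
  have DD: "(\<lambda>x y. x \<in> D \<and> y \<in> D \<and> E x y)\<^sup>*\<^sup>* a x" if "R\<^sup>*\<^sup>* a x" for x
    using that
  proof (induction rule: rtranclp_induct)
    case (step y z)
    then have "y \<in> D" "z \<in> D" "E y z"
      by (auto simp: D_def R_def intro: rtranclp.rtrancl_into_rtrancl)
    then show ?case using step.IH by (metis (mono_tags, lifting) rtranclp.rtrancl_into_rtrancl)
  qed simp
  have DDsym: "(\<lambda>x y. x \<in> D \<and> y \<in> D \<and> E x y)\<^sup>*\<^sup>* y x"
    if "(\<lambda>x y. x \<in> D \<and> y \<in> D \<and> E x y)\<^sup>*\<^sup>* x y" for x y
    using that
  proof (induction rule: rtranclp_induct)
    case (step y z)
    then have "z \<in> D \<and> y \<in> D \<and> E z y" using adjacent_sym[OF wf] by (auto simp: E_iff)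
    then show ?case
      using step.IH
      by (metis (mono_tags, lifting) converse_rtranclp_into_rtranclp)
  qed simp
  have conn: "graph_connected E D"
    unfolding graph_connected_def
    using DD DDsym by (metis (no_types, lifting) D_def mem_Collect_eq rtranclp_trans)
  have "tri_component (induced T X) D"
    unfolding tri_component_def graph_component_def vX E_def[symmetric]
  proof (intro conjI allI impI DX conn)
    fix D' assume D': "D \<subseteq> D' \<and> D' \<subseteq> X \<and> graph_connected E D'"
    have "a \<in> D'" using D' by (auto simp: D_def)
    have "x \<in> D" if "x \<in> D'" for x
    proof -
      have "(\<lambda>x y. x \<in> D' \<and> y \<in> D' \<and> E x y)\<^sup>*\<^sup>* a x"
        using D' \<open>a \<in> D'\<close> that by (auto simp: graph_connected_def)
      then have "R\<^sup>*\<^sup>* a x"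
        by (rule rtranclp_mono[THEN predicate2D, rotated]) (use D' in \<open>auto simp: R_def\<close>)
      then show ?thesis by (simp add: D_def)
    qed
    then show "D' = D" using D' by blast
  qed
  then obtain b where b: "b \<in> B" "R\<^sup>*\<^sup>* a b"
    using comp[of D] by (auto simp: X_def D_def)
  define W where "W = (\<lambda>w. w \<noteq> [] \<and> hd w \<in> A \<and> last w \<in> B \<and> set w \<subseteq> X \<and>
     (\<forall>i. Suc i < length w \<longrightarrow> adjacent T (w ! i) (w ! Suc i)))"
  have "\<exists>w. w \<noteq> [] \<and> hd w = a \<and> last w = x \<and> set w \<subseteq> X \<and>
     (\<forall>i. Suc i < length w \<longrightarrow> adjacent T (w ! i) (w ! Suc i))" if "R\<^sup>*\<^sup>* a x" for x
    using that
  proof (induction rule: rtranclp_induct)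
    case base
    then show ?case by (intro exI[of _ "[a]"]) (auto simp: aX)
  next
    case (step y z)
    then obtain w where w: "w \<noteq> []" "hd w = a" "last w = y" "set w \<subseteq> X"
      "\<And>i. Suc i < length w \<Longrightarrow> adjacent T (w ! i) (w ! Suc i)" by blast
    have yz: "adjacent T y z" "z \<in> X" using step.hyps by (auto simp: R_def E_iff)
    have "adjacent T ((w @ [z]) ! i) ((w @ [z]) ! Suc i)" if "Suc i < length (w @ [z])" for i
    proof (cases "Suc i < length w")
      case True
      then show ?thesis using w(5) by (simp add: nth_append)
    next
      case False
      then have "i = length w - 1" "Suc i = length w" using that w(1) by auto
      then show ?thesis using w(1,3) yz by (simp add: nth_append last_conv_nth)
    qed
    then show ?case using w yz by (intro exI[of _ "w @ [z]"]) auto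
  qed
  then have "\<exists>w. W w" using a b unfolding W_def by metis
  then obtain w where w: "W w" and min: "\<And>w'. W w' \<Longrightarrow> length w \<le> length w'"
    using ex_has_least_nat[of W _ length] by metis
  have adj: "Suc i < length w \<Longrightarrow> adjacent T (w ! i) (w ! Suc i)" for i
    using w by (auto simp: W_def)
  have wX: "set w \<subseteq> X" and wne: "w \<noteq> []" and hdA: "hd w \<in> A" and laB: "last w \<in> B"
    using w by (auto simp: W_def)
  have noA: "w ! k \<notin> A" if "0 < k" "k < length w" for k
  proof
    assume "w ! k \<in> A"
    then have "W (drop k w)"
      using that wX laB adj
      by (auto simp: W_def hd_drop_conv_nth dest: in_set_dropD)
    then show False using min[of "drop k w"] that by simp
  qed
  have noB: "w ! k \<notin> B" if "Suc k < length w" for k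
  proof
    assume "w ! k \<in> B"
    moreover have "take (Suc k) w \<noteq> []" using that by auto
    moreover have "last (take (Suc k) w) = w ! k" using that
      by (simp add: take_Suc_conv_app_nth)
    moreover have "hd (take (Suc k) w) = hd w" by simp
    ultimately have "W (take (Suc k) w)"
      using that wX hdA adj by (auto simp: W_def dest: in_set_takeD)
    then show False using min[of "take (Suc k) w"] that by simp
  qed
  have short: "\<not> adjacent T (w ! i) (w ! j)" if "Suc i < j" "j < length w" for i j
  proof
    assume ad: "adjacent T (w ! i) (w ! j)"
    let ?u = "take (Suc i) w @ drop j w"
    have lt: "length (take (Suc i) w) = Suc i" using that by simp
    have "adjacent T (?u ! k) (?u ! Suc k)" if k: "Suc k < length ?u" for k
    proof -
      consider "k < i" | "k = i" | "i < k" by linarith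
      then show ?thesis
      proof cases
        case 1 then show ?thesis using adj that \<open>Suc i < j\<close> \<open>j < length w\<close> by (simp add: nth_append)
      next
        case 2 then show ?thesis using ad \<open>Suc i < j\<close> \<open>j < length w\<close> by (simp add: nth_append)
      next
        case 3
        then have "?u ! k = w ! (j + (k - Suc i))" "?u ! Suc k = w ! Suc (j + (k - Suc i))"
          using \<open>Suc i < j\<close> \<open>j < length w\<close> lt
          by (auto simp: nth_append intro!: arg_cong[where f = "(!) w"])
        moreover have "Suc (j + (k - Suc i)) < length w"
          using k 3 \<open>Suc i < j\<close> \<open>j < length w\<close> by auto
        ultimately show ?thesis using adj by simp
      qed
    qed
    moreover have "hd ?u = hd w" using wne by (simp add: hd_append)
    moreover have "last ?u = last w" using that by simp
    moreover have "set ?u \<subseteq> X" using wX by (auto dest: in_set_takeD in_set_dropD)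
    ultimately have "W ?u" using hdA laB wne by (auto simp: W_def)
    then show False using min[of ?u] that by simp
  qed
  have neq: "w ! i \<noteq> w ! j" if "i < j" "j < length w" for i j
  proof
    assume eq: "w ! i = w ! j"
    show False
    proof (cases "i = 0")
      case True
      then show False using noA[of j] that eq hdA wne by (simp add: hd_conv_nth)
    next
      case False
      then obtain i' where i': "i = Suc i'" by (cases i) auto
      then show False using adj[of i'] short[of i' j] that eq by auto
    qed
  qed
  have dist: "distinct w" unfolding distinct_conv_nth
    by (metis neq nat_neq_iff)
  have vsub: "set w \<subseteq> verts T" using wX sub by (auto simp: X_def)
  have "is_path T w"
    unfolding is_path_def
  proof (intro conjI allI impI wne dist vsub)
    fix i j assume ij: "i < j \<and> j < length w"
    have "antiadjacent T (w ! i) (w ! j)" if "Suc i < j"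
    proof -
      have v: "w ! i \<in> verts T" "w ! j \<in> verts T" "w ! i \<noteq> w ! j"
        using vsub ij neq by (simp_all add: subset_iff)
      then have "theta T (w ! i) (w ! j) \<in> {-1, 0, 1}"
        using wf unfolding wf_trigraph_def by blast
      then show ?thesis using short[OF that] ij v
        unfolding adjacent_def antiadjacent_def by blast
    qed
    moreover have "adjacent T (w ! i) (w ! j)" if "j - i = 1"
    proof -
      have "j = Suc i" using that by linarith
      then show ?thesis using adj[of i] ij by blast
    qed
    ultimately show "if j - i = 1 then adjacent T (w ! i) (w ! j)
        else antiadjacent T (w ! i) (w ! j)" using ij by auto
  qed
  moreover have "path_interior w \<subseteq> C"
  proof
    fix x assume "x \<in> path_interior w"
    then obtain i where i: "0 < i" "i < length w - 1" "x = w ! i" using path_interior_conv by metis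
    then have "x \<in> X" "x \<notin> A" "x \<notin> B" using noA[of i] noB[of i] wX by auto
    then show "x \<in> C" by (simp add: X_def)
  qed
  ultimately show ?thesis using hdA laB by (auto simp: side_path_def)
qed

lemma side_path_cases:
  assumes "side_path T A B C p" "A \<inter> B = {}" "A \<inter> C = {}" "B \<inter> C = {}" "i < length p"
  shows "p ! i \<in> A \<union> B \<union> C" "p ! i \<in> A \<longleftrightarrow> i = 0" "p ! i \<in> B \<longleftrightarrow> i = length p - 1"
    "length p \<ge> 2"
proof -
  have p: "p \<noteq> []" "p ! 0 \<in> A" "p ! (length p - 1) \<in> B" "path_interior p \<subseteq> C"
    using assms(1) by (auto simp: side_path_def is_path_def hd_conv_nth last_conv_nth)
  have "length p \<noteq> 1" using p assms(2) by auto
  then show l: "length p \<ge> 2" using p(1) by (cases p) (auto simp: Suc_le_eq)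
  consider "i = 0" | "i = length p - 1" | "0 < i" "i < length p - 1" using assms(5) by linarith
  then have "p ! i \<in> A \<union> B \<union> C \<and> (p ! i \<in> A \<longleftrightarrow> i = 0) \<and> (p ! i \<in> B \<longleftrightarrow> i = length p - 1)"
  proof cases
    case 3
    then have "p ! i \<in> C" using path_interior_nth[of i p] p(4) by blast
    then show ?thesis using 3 assms by auto
  qed (use p assms l in auto)
  then show "p ! i \<in> A \<union> B \<union> C" "p ! i \<in> A \<longleftrightarrow> i = 0" "p ! i \<in> B \<longleftrightarrow> i = length p - 1"
    by auto
qed

lemma side_paths_hole:
  assumes wf: "wf_trigraph T" and tj: "two_join T A1 B1 C1 A2 B2 C2"
    and p: "side_path T A1 B1 C1 p" and q: "side_path T A2 B2 C2 q"
  shows "is_hole T (p @ rev q)"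
proof -
  define X1 where "X1 = A1 \<union> B1 \<union> C1"
  define X2 where "X2 = A2 \<union> B2 \<union> C2"
  have X: "X1 \<inter> X2 = {}" "A1 \<inter> B1 = {}" "A1 \<inter> C1 = {}" "B1 \<inter> C1 = {}"
      "A2 \<inter> B2 = {}" "A2 \<inter> C2 = {}" "B2 \<inter> C2 = {}"
      "strongly_complete T A1 A2" "strongly_complete T B1 B2"
      "\<And>u v. u \<in> X1 \<Longrightarrow> v \<in> X2 \<Longrightarrow> \<not> (u \<in> A1 \<and> v \<in> A2) \<Longrightarrow> \<not> (u \<in> B1 \<and> v \<in> B2) \<Longrightarrow>
          strongly_antiadjacent T u v"
    using tj unfolding two_join_def Let_def X1_def X2_def by auto
  note pc = side_path_cases[OF p X(2-4)] and qc = side_path_cases[OF q X(5-7)]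
  have ip: "is_path T p" and iq: "is_path T q" using p q by (auto simp: side_path_def)
  let ?m = "length p" and ?n = "length q" and ?h = "p @ rev q"
  have m: "?m \<ge> 2" using pc(4)[of 0] ip by (auto simp: is_path_def)
  have n: "?n \<ge> 2" using qc(4)[of 0] iq by (auto simp: is_path_def)
  have cross: "if (i = 0 \<and> k = 0) \<or> (i = ?m - 1 \<and> k = ?n - 1)
      then adjacent T (p ! i) (q ! k) else antiadjacent T (p ! i) (q ! k)"
    if "i < ?m" "k < ?n" for i k
  proof (cases "(i = 0 \<and> k = 0) \<or> (i = ?m - 1 \<and> k = ?n - 1)")
    case True
    then have "strongly_adjacent T (p ! i) (q ! k)"
      using pc[OF that(1)] qc[OF that(2)] X(8,9) by (auto simp: strongly_complete_def)
    then show ?thesis using True by (auto simp: strongly_adjacent_def adjacent_def)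
  next
    case False
    then have "strongly_antiadjacent T (p ! i) (q ! k)"
      using pc[OF that(1)] qc[OF that(2)] X(10)[of "p ! i" "q ! k"] by (auto simp: X1_def X2_def)
    then have "antiadjacent T (p ! i) (q ! k)"
      by (auto simp: strongly_antiadjacent_def antiadjacent_def)
    then show ?thesis using False by presburger
  qed
  have sp: "set p \<subseteq> X1" unfolding X1_def using pc(1) by (metis in_set_conv_nth subsetI)
  have sq: "set q \<subseteq> X2" unfolding X2_def using qc(1) by (metis in_set_conv_nth subsetI)
  have "distinct ?h" "set ?h \<subseteq> verts T" using ip iq sp sq X(1) by (auto simp: is_path_def)
  moreover have "if j - i \<in> {1, length ?h - 1} then adjacent T (?h ! i) (?h ! j)
         else antiadjacent T (?h ! i) (?h ! j)" if ij: "i < j \<and> j < length ?h" for i j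
  proof -
    consider "j < ?m" | "i < ?m" "?m \<le> j" | "?m \<le> i" using ij by linarith
    then show ?thesis
    proof cases
      case 1
      then have e: "?h ! i = p ! i" "?h ! j = p ! j" using ij by (auto simp: nth_append)
      have "j - i \<noteq> length ?h - 1" using 1 n by auto
      then show ?thesis using ip ij 1 unfolding is_path_def e by auto
    next
      case 2
      define k where "k = ?n - 1 - (j - ?m)"
      have k: "k < ?n" and e: "?h ! i = p ! i" "?h ! j = q ! k"
        using 2 ij by (auto simp: nth_append rev_nth k_def)
      have "j - i \<in> {1, length ?h - 1} \<longleftrightarrow> (i = 0 \<and> k = 0) \<or> (i = ?m - 1 \<and> k = ?n - 1)"
        using 2 ij m n by (auto simp: k_def)
      then show ?thesis using cross[OF 2(1) k] unfolding e by simp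
    next
      case 3
      define k where "k = ?n - 1 - (i - ?m)"
      define l where "l = ?n - 1 - (j - ?m)"
      have kl: "l < k" "k < ?n" "j - i = k - l" and e: "?h ! i = q ! k" "?h ! j = q ! l"
        using 3 ij by (auto simp: nth_append rev_nth k_def l_def)
      have "j - i \<noteq> length ?h - 1" using 3 ij m by auto
      moreover have "if k - l = 1 then adjacent T (q ! l) (q ! k) else antiadjacent T (q ! l) (q ! k)"
        using iq kl unfolding is_path_def by blast
      ultimately show ?thesis using kl(3) adjacent_sym[OF wf] antiadjacent_sym[OF wf]
        unfolding e by (auto split: if_splits)
    qed
  qed
  ultimately show ?thesis using m n unfolding is_hole_def by auto
qed

lemma proper_two_join_side_paths:
  assumes "wf_trigraph T" "proper_two_join T A1 B1 C1 A2 B2 C2"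
  obtains p q where "side_path T A1 B1 C1 p" "side_path T A2 B2 C2 q"
proof -
  have "\<exists>p. side_path T A1 B1 C1 p" "\<exists>p. side_path T A2 B2 C2 p"
    by (rule side_path_exists[OF assms(1)];
        use assms(2) in \<open>auto simp: proper_two_join_def two_join_def good_side_def Let_def\<close>)+
  then show ?thesis using that by blast
qed

lemma proper_two_join_not_odd_even:
  assumes "wf_trigraph T" "proper_two_join T A1 B1 C1 A2 B2 C2"
  shows "\<not> (odd_join T A1 B1 C1 A2 B2 C2 \<and> even_join T A1 B1 C1 A2 B2 C2)"
  using proper_two_join_side_paths[OF assms] unfolding odd_join_def even_join_def by metis

lemma proper_two_join_parity:
  assumes wf: "wf_trigraph T" and "berge T" and pj: "proper_two_join T A1 B1 C1 A2 B2 C2"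
  shows "odd_join T A1 B1 C1 A2 B2 C2 \<or> even_join T A1 B1 C1 A2 B2 C2"
proof -
  obtain p0 q0 where pq: "side_path T A1 B1 C1 p0" "side_path T A2 B2 C2 q0"
    using proper_two_join_side_paths[OF wf pj] .
  have "even (path_length p) \<longleftrightarrow> even (path_length q)"
    if "side_path T A1 B1 C1 p" "side_path T A2 B2 C2 q" for p q
  proof -
    have "is_hole T (p @ rev q)"
      using side_paths_hole[OF wf _ that] pj by (auto simp: proper_two_join_def)
    then have "even (length p + length q)"
      using \<open>berge T\<close> unfolding berge_def by (metis length_append length_rev)
    moreover have "length p \<ge> 1" "length q \<ge> 1"
      using that by (auto simp: side_path_def is_path_def Suc_le_eq)
    ultimately show ?thesis by (auto simp: path_length_def)
  qed
  then show ?thesis using pq unfolding odd_join_def even_join_def by metis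
qed

lemma wf_trigraph_tri_complement: "wf_trigraph T \<Longrightarrow> wf_trigraph (tri_complement T)"
  by (auto simp: wf_trigraph_def tri_complement_def)

lemma tri_complement_involution: "tri_complement (tri_complement T) = T"
  by (cases T) (simp add: tri_complement_def)

lemma berge_tri_complement: "berge T \<Longrightarrow> berge (tri_complement T)"
  by (auto simp: berge_def is_antihole_def tri_complement_involution)

lemma fragment_has_block:
  assumes "T \<in> class_F" "fragment T X"
  shows "\<exists>TX. is_block T X TX"
proof -
  have T: "wf_trigraph T" "berge T" using assms(1) by (auto simp: class_F_def)
  note par = proper_two_join_parity[OF T]
    proper_two_join_parity[OF wf_trigraph_tri_complement[OF T(1)] berge_tri_complement[OF T(2)]]
  show ?thesis
    using assms(2) par unfolding fragment_def is_block_def proper_complement_two_join_def by metis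
qed

end

theory Submission
  imports Defs
begin

text \<open>Passing to the complement reduces complement 2-joins to 2-joins. Pull a balanced
  skew-partition \<open>(A', B')\<close> of the block back along the map \<open>\<phi>\<close> that collapses the second side of the
  2-join onto the markers. The marker \<open>c\<close> is not in \<open>B'\<close>, because no vertex is strongly adjacent to
  it, and not both of \<open>a\<close>, \<open>b\<close> are in \<open>B'\<close>, because no vertex is strongly adjacent to both; say
  \<open>a\<close> is not. So the pullback is a skew-partition of \<open>T\<close>.

  It is balanced: an odd path violating this meets \<open>A2\<close> and \<open>B2\<close> at most once each and meets \<open>C2\<close>
  only in a side path, which can be contracted to the markers without changing the parity (the
  remaining possibilities contradict the parity of side paths or yield an odd hole). An odd
  antipath violating this meets each of \<open>A2\<close>, \<open>B2\<close>, \<open>C2\<close> at most once, or else there is an odd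
  antihole, and so \<open>\<phi>\<close> maps it to an antipath of the block.\<close>

section \<open>Connectivity and complementation\<close>

text \<open>The obstacle is that \<open>\<phi>\<close> is not injective, since \<open>A2\<close>,
  \<open>B2\<close> and \<open>C2\<close> may be large. Off the collapsed pairs it respects
  adjacency and antiadjacency, because pairs of markers are switchable and a switchable pair counts
  as both. The one exception is \<open>a\<close>, \<open>b\<close> in the even case; there parity
  rules out any edge between \<open>A2\<close> and \<open>B2\<close>. So a path or antipath
  transfers as soon as \<open>\<phi>\<close> is injective on it and maps it to vertices of the
  block. Injectivity is forced because no switchable pair crosses the 2-join: a vertex of the first
  side sees all of \<open>A2\<close> or none of it, so several vertices of \<open>A2\<close> on one
  path cannot be told apart from outside. Keeping \<open>a\<close> out of \<open>B'\<close> matters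
  for disconnectedness: the markers outside \<open>B'\<close> form a connected set containing
  \<open>a\<close>, so some part of the separation of \<open>A'\<close> comes entirely from the
  first side and stays separated in \<open>T\<close>.\<close>

lemma not_graph_connected_iff:
  "\<not> graph_connected E X \<longleftrightarrow>
     (\<exists>Y Z. Y \<noteq> {} \<and> Z \<noteq> {} \<and> Y \<union> Z = X \<and> Y \<inter> Z = {} \<and> (\<forall>y\<in>Y. \<forall>z\<in>Z. \<not> E y z))"
    (is "?L \<longleftrightarrow> ?R")
proof
  let ?P = "\<lambda>x y. x \<in> X \<and> y \<in> X \<and> E x y"
  assume ?L
  then obtain u v where uv: "u \<in> X" "v \<in> X" "\<not> ?P\<^sup>*\<^sup>* u v"
    unfolding graph_connected_def by blast
  let ?Y = "{x \<in> X. ?P\<^sup>*\<^sup>* u x}"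
  have "\<not> E y z" if "y \<in> ?Y" "z \<in> X - ?Y" for y z
  proof
    assume "E y z"
    then have "?P y z" using that by blast
    moreover have "?P\<^sup>*\<^sup>* u y" using that by blast
    ultimately have "?P\<^sup>*\<^sup>* u z" by (rule rtranclp.rtrancl_into_rtrancl[rotated])
    then show False using that by blast
  qed
  then have *: "\<forall>y\<in>?Y. \<forall>z\<in>X - ?Y. \<not> E y z" by blast
  have "?Y \<noteq> {}" "X - ?Y \<noteq> {}" using uv by auto
  moreover have "?Y \<union> (X - ?Y) = X" "?Y \<inter> (X - ?Y) = {}" by auto
  ultimately show ?R using * by (intro exI[of _ ?Y] exI[of _ "X - ?Y"]) (intro conjI)
next
  let ?P = "\<lambda>x y. x \<in> X \<and> y \<in> X \<and> E x y"
  assume ?R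
  then obtain Y Z where YZ: "Y \<noteq> {}" "Z \<noteq> {}" "Y \<union> Z = X" "Y \<inter> Z = {}"
    "\<forall>y\<in>Y. \<forall>z\<in>Z. \<not> E y z" by metis
  then obtain y z where yz: "y \<in> Y" "z \<in> Z" by blast
  have "x \<in> Y" if "?P\<^sup>*\<^sup>* y x" for x
    using that
  proof (induction rule: rtranclp_induct)
    case base
    then show ?case by (rule yz)
  next
    case (step x z)
    then show ?case using YZ(3,5) by blast
  qed
  then have "\<not> ?P\<^sup>*\<^sup>* y z" using YZ yz by blast
  then show ?L using YZ yz unfolding graph_connected_def by blast
qed

text \<open>Later proofs see connectivity only through such bipartitions: complementation turns
  those of disconnected sets into those of non-anticonnected sets, and preimages under
  \<open>\<phi>\<close> carry them back to \<open>T\<close>.\<close>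

lemma not_tri_connected_iff:
  "\<not> tri_connected T A \<longleftrightarrow>
     (\<exists>Y Z. Y \<noteq> {} \<and> Z \<noteq> {} \<and> Y \<union> Z = A \<and> Y \<inter> Z = {} \<and> (\<forall>y\<in>Y. \<forall>z\<in>Z. \<not> adjacent T y z))"
  unfolding tri_connected_def not_graph_connected_iff ..

lemma not_tri_anticonnected_iff:
  "\<not> tri_anticonnected T B \<longleftrightarrow>
     (\<exists>Y Z. Y \<noteq> {} \<and> Z \<noteq> {} \<and> Y \<union> Z = B \<and> Y \<inter> Z = {} \<and>
        (\<forall>y\<in>Y. \<forall>z\<in>Z. strongly_adjacent T y z))"
    (is "?L \<longleftrightarrow> (\<exists>Y Z. ?R Y Z)")
proof -
  have "?R Y Z \<longleftrightarrow> Y \<noteq> {} \<and> Z \<noteq> {} \<and> Y \<union> Z = B \<and> Y \<inter> Z = {} \<and>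
      (\<forall>y\<in>Y. \<forall>z\<in>Z. \<not> (y \<noteq> z \<and> \<not> strongly_adjacent T y z))" for Y Z
    by (intro conj_cong refl) (metis disjoint_iff)
  then show ?thesis unfolding tri_anticonnected_def not_graph_connected_iff by (simp only:)
qed

lemma verts_tri_complement [simp]: "verts (tri_complement T) = verts T"
  by (simp add: tri_complement_def)

lemma adjacent_tri_complement [simp]: "adjacent (tri_complement T) u v = antiadjacent T u v"
  by (auto simp: tri_complement_def adjacent_def antiadjacent_def)

lemma antiadjacent_tri_complement [simp]:
  "antiadjacent (tri_complement T) u v = adjacent T u v"
  by (auto simp: tri_complement_def adjacent_def antiadjacent_def)

lemma not_adjacent_iff:
  assumes "wf_trigraph T" "u \<in> verts T" "v \<in> verts T" "u \<noteq> v"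
  shows "\<not> adjacent T u v \<longleftrightarrow> strongly_antiadjacent T u v"
    and "\<not> antiadjacent T u v \<longleftrightarrow> strongly_adjacent T u v"
proof -
  have "theta T u v \<in> {-1, 0, 1}" using assms unfolding wf_trigraph_def by blast
  then show "\<not> adjacent T u v \<longleftrightarrow> strongly_antiadjacent T u v"
    "\<not> antiadjacent T u v \<longleftrightarrow> strongly_adjacent T u v"
    using assms by (auto simp: adjacent_def antiadjacent_def strongly_adjacent_def
        strongly_antiadjacent_def)
qed

lemma skew_partition_tri_complement:
  assumes wf: "wf_trigraph T" and "skew_partition T A B"
  shows "skew_partition (tri_complement T) B A"
proof -
  have AB: "A \<union> B = verts T" "A \<inter> B = {}" "\<not> tri_connected T A" "\<not> tri_anticonnected T B"
    using assms(2) by (auto simp: skew_partition_def)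
  obtain Y Z where YZ: "Y \<noteq> {}" "Z \<noteq> {}" "Y \<union> Z = A" "Y \<inter> Z = {}"
      "\<forall>y\<in>Y. \<forall>z\<in>Z. \<not> adjacent T y z"
    using AB(3) unfolding not_tri_connected_iff by blast
  obtain V W where VW: "V \<noteq> {}" "W \<noteq> {}" "V \<union> W = B" "V \<inter> W = {}"
      "\<forall>y\<in>V. \<forall>z\<in>W. strongly_adjacent T y z"
    using AB(4) unfolding not_tri_anticonnected_iff by blast
  have "\<forall>y\<in>V. \<forall>z\<in>W. \<not> adjacent (tri_complement T) y z"
    using VW(5) by (simp add: strongly_adjacent_def antiadjacent_def)
  then have "\<not> tri_connected (tri_complement T) B"
    unfolding not_tri_connected_iff using VW by blast
  moreover have "strongly_adjacent (tri_complement T) y z" if "y \<in> Y" "z \<in> Z" for y z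
  proof -
    have "y \<in> verts T" "z \<in> verts T" "y \<noteq> z" "\<not> adjacent T y z" using that YZ AB(1) by auto
    then have "strongly_antiadjacent T y z" using not_adjacent_iff[OF wf] by blast
    then show ?thesis
      by (simp add: strongly_adjacent_def strongly_antiadjacent_def tri_complement_def)
  qed
  then have "\<not> tri_anticonnected (tri_complement T) A"
    unfolding not_tri_anticonnected_iff using YZ by blast
  ultimately show ?thesis using AB(1,2) by (auto simp: skew_partition_def)
qed

lemma has_balanced_skew_partition_tri_complement:
  assumes "wf_trigraph T" "has_balanced_skew_partition T"
  shows "has_balanced_skew_partition (tri_complement T)"
proof -
  obtain A B where "balanced_skew_partition T A B"
    using assms(2) by (auto simp: has_balanced_skew_partition_def)
  then have "balanced_skew_partition (tri_complement T) B A"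
    using skew_partition_tri_complement[OF assms(1)]
    by (auto simp: balanced_skew_partition_def is_antipath_def tri_complement_involution)
  then show ?thesis by (auto simp: has_balanced_skew_partition_def)
qed


section \<open>Paths and holes\<close>

lemma path_nth_adjacent: "is_path T p \<Longrightarrow> Suc i < length p \<Longrightarrow> adjacent T (p ! i) (p ! Suc i)"
  by (auto simp: is_path_def)

lemma path_nth_antiadjacent:
  "is_path T p \<Longrightarrow> Suc i < j \<Longrightarrow> j < length p \<Longrightarrow> antiadjacent T (p ! i) (p ! j)"
  unfolding is_path_def by (metis Suc_eq_plus1 Suc_lessD le_add_diff_inverse less_imp_le
      less_not_refl)

lemma path_nth_verts: "is_path T p \<Longrightarrow> i < length p \<Longrightarrow> p ! i \<in> verts T"
  by (auto simp: is_path_def)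

text \<open>Both adjacency relations include distinctness and membership in \<open>verts T\<close>,
  so these conjuncts of \<open>is_path\<close> come out of the pairwise conditions. The bound on the
  length excludes the one-vertex list, which has no pair to read them off.\<close>

lemma is_pathI:
  assumes "length p \<ge> 2"
    and adj: "\<And>i. Suc i < length p \<Longrightarrow> adjacent T (p ! i) (p ! Suc i)"
    and anti: "\<And>i j. Suc i < j \<Longrightarrow> j < length p \<Longrightarrow> antiadjacent T (p ! i) (p ! j)"
  shows "is_path T p"
proof -
  have *: "if j - i = 1 then adjacent T (p ! i) (p ! j) else antiadjacent T (p ! i) (p ! j)"
    if "i < j" "j < length p" for i j
  proof (cases "j = Suc i")
    case True
    then show ?thesis using adj that by simp
  next
    case False
    then show ?thesis using anti[of i j] that by auto
  qed
  have **: "p ! i \<noteq> p ! j \<and> p ! i \<in> verts T \<and> p ! j \<in> verts T" if "i < j" "j < length p" for i j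
    using *[OF that] by (auto simp: adjacent_def antiadjacent_def split: if_splits)
  have "distinct p" unfolding distinct_conv_nth using ** by (metis nat_neq_iff)
  moreover have "p ! i \<in> verts T" if "i < length p" for i
    using **[of 0 i] **[of i "Suc i"] that assms(1) by (cases "i = 0") auto
  then have "set p \<subseteq> verts T" by (auto simp: in_set_conv_nth)
  ultimately show ?thesis using * assms(1) unfolding is_path_def by auto
qed

text \<open>Injectivity of \<open>f\<close> along the path comes for free: any two vertices of the
  path are adjacent or antiadjacent, hence so are their images, and neither relation of
  \<open>S\<close> relates a vertex to itself.\<close>

lemma is_path_map:
  assumes "is_path T p" "length p \<ge> 2"
    and "\<And>u v. u \<in> set p \<Longrightarrow> v \<in> set p \<Longrightarrow> adjacent T u v \<Longrightarrow> adjacent S (f u) (f v)"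
    and "\<And>u v. u \<in> set p \<Longrightarrow> v \<in> set p \<Longrightarrow> antiadjacent T u v \<Longrightarrow> antiadjacent S (f u) (f v)"
  shows "is_path S (map f p)"
proof (rule is_pathI)
  fix i assume "Suc i < length (map f p)"
  then show "adjacent S (map f p ! i) (map f p ! Suc i)"
    using assms(3)[of "p ! i" "p ! Suc i"] path_nth_adjacent[OF assms(1), of i] by simp
next
  fix i j assume "Suc i < j" "j < length (map f p)"
  then show "antiadjacent S (map f p ! i) (map f p ! j)"
    using assms(4)[of "p ! i" "p ! j"] path_nth_antiadjacent[OF assms(1), of i j] by simp
qed (use assms(2) in simp)

lemma is_path_rev:
  assumes wf: "wf_trigraph T" and p: "is_path T p"
  shows "is_path T (rev p)"
proof (cases "length p \<ge> 2")
  case True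
  then show ?thesis
  proof (intro is_pathI)
    fix i assume "Suc i < length (rev p)"
    then show "adjacent T (rev p ! i) (rev p ! Suc i)"
      using path_nth_adjacent[OF p, of "length p - Suc (Suc i)"] adjacent_sym[OF wf]
      by (simp add: rev_nth Suc_diff_Suc)
  next
    fix i j assume "Suc i < j" "j < length (rev p)"
    then show "antiadjacent T (rev p ! i) (rev p ! j)"
      using path_nth_antiadjacent[OF p, of "length p - Suc j" "length p - Suc i"]
        antiadjacent_sym[OF wf]
      by (auto simp: rev_nth)
  qed auto
next
  case False
  then have "length p = 1" using p unfolding is_path_def
    by (metis One_nat_def Suc_1 le_antisym length_0_conv not_less_eq_eq Suc_le_eq neq0_conv)
  then have "rev p = p" by (cases p) auto
  then show ?thesis using p by simp
qed

lemma is_path_segment: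
  assumes p: "is_path T p" and "i < j" "j < length p"
  shows "is_path T (map ((!) p) [i..<Suc j])"
proof (rule is_pathI)
  fix k assume "Suc k < length (map ((!) p) [i..<Suc j])"
  then show "adjacent T (map ((!) p) [i..<Suc j] ! k) (map ((!) p) [i..<Suc j] ! Suc k)"
    using path_nth_adjacent[OF p, of "i + k"] assms(2,3) by (simp del: upt_Suc)
next
  fix k l assume "Suc k < l" "l < length (map ((!) p) [i..<Suc j])"
  then show "antiadjacent T (map ((!) p) [i..<Suc j] ! k) (map ((!) p) [i..<Suc j] ! l)"
    using path_nth_antiadjacent[OF p, of "i + k" "i + l"] assms(2,3) by (simp del: upt_Suc)
qed (use assms(2) in simp)

lemma path_interior_rev: "path_interior (rev p) = path_interior p"
proof -
  have "butlast (tl (rev p)) = rev (butlast (tl p))"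
    by (metis butlast_rev butlast_tl rev_rev_ident)
  then show ?thesis by (simp add: path_interior_def)
qed

text \<open>The new hole has one vertex more than \<open>p\<close>. For an even number of vertices,
  in \<open>T\<close> or in its complement, this contradicts \<open>berge T\<close>.\<close>

lemma hole_Cons:
  assumes p: "is_path T p" and l: "length p \<ge> 3"
    and adj: "adjacent T v (p ! 0)" "adjacent T v (p ! (length p - 1))"
    and anti: "\<And>i. 0 < i \<Longrightarrow> i < length p - 1 \<Longrightarrow> antiadjacent T v (p ! i)"
  shows "is_hole T (v # p)"
proof -
  have "v \<noteq> p ! i" if "i < length p" for i
  proof -
    consider "i = 0" | "i = length p - 1" | "0 < i" "i < length p - 1" using \<open>i < length p\<close> by linarith
    then show ?thesis using adj anti by cases (auto simp: adjacent_def antiadjacent_def)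
  qed
  then have "v \<notin> set p" by (auto simp: in_set_conv_nth)
  moreover have "if j - i \<in> {1, length (v # p) - 1} then adjacent T ((v # p) ! i) ((v # p) ! j)
      else antiadjacent T ((v # p) ! i) ((v # p) ! j)" if ij: "i < j \<and> j < length (v # p)" for i j
  proof (cases i)
    case 0
    obtain j' where "j = Suc j'" using ij by (cases j) auto
    moreover have "j' = length p - 1" if "j = length p" using \<open>j = Suc j'\<close> that by simp
    ultimately show ?thesis using 0 adj anti[of j'] ij l by (cases "j = length p"; cases "j' = 0") auto
  next
    case (Suc i')
    obtain j' where "j = Suc j'" using ij by (cases j) auto
    moreover have "if j' - i' = 1 then adjacent T (p ! i') (p ! j') else antiadjacent T (p ! i') (p ! j')"
      using p ij Suc \<open>j = Suc j'\<close> unfolding is_path_def by auto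
    ultimately show ?thesis using Suc ij by auto
  qed
  moreover have "v \<in> verts T" "distinct p" "set p \<subseteq> verts T"
    using p adj by (simp_all add: is_path_def adjacent_def)
  moreover have "4 \<le> length (v # p)" using l by simp
  ultimately show ?thesis unfolding is_hole_def by (metis distinct.simps(2) insert_subset list.simps(15))
qed


text \<open>A discrete intermediate value argument. The order of \<open>x\<close> and
  \<open>y\<close> is unknown, so the two neighbours may come in either order; the bounds will show
  that \<open>m'\<close> is not an end of an antipath.\<close>

lemma exists_switch:
  assumes "P x" "\<not> P (y :: nat)"
  obtains m m' where "m' = Suc m \<or> m = Suc m'" "P m" "\<not> P m'"
    "min x y \<le> m" "m \<le> max x y" "min x y \<le> m'" "m' \<le> max x y"
proof -
  have gen: "\<exists>m. x \<le> m \<and> Suc m \<le> y \<and> Q m \<and> \<not> Q (Suc m)" if "x \<le> y" "Q x" "\<not> Q y"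
    for Q and x y :: nat
    using that by (induction y rule: dec_induct) (metis le_SucI le_refl)+
  have "x \<noteq> y" using assms by metis
  then consider "x < y" | "y < x" by linarith
  then show ?thesis
  proof cases
    case 1
    then obtain m where "x \<le> m" "Suc m \<le> y" "P m" "\<not> P (Suc m)" using gen[of x y P] assms by auto
    then show ?thesis using that[of "Suc m" m] by auto
  next
    case 2
    then obtain m where "y \<le> m" "Suc m \<le> x" "\<not> P m" "P (Suc m)"
      using gen[of y x "\<lambda>k. \<not> P k"] assms by auto
    then show ?thesis using that[of m "Suc m"] by auto
  qed
qed

lemma odd_path_length_iff: "odd (path_length p) \<and> path_length p > 1 \<longleftrightarrow>
    even (length p) \<and> 4 \<le> length p"
  unfolding path_length_def by presburger

text \<open>These data let \<open>q\<close> violate balance in \<open>S\<close> whenever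
  \<open>p\<close> does so in \<open>T\<close>. A relation rather than \<open>map f p\<close>,
  because contracting a stretch of \<open>p\<close> gives a shorter list. Parity is now counted in
  vertices: an odd length above 1 means an even number of vertices, at least 4.\<close>

definition odd_path_image :: "'b trigraph \<Rightarrow> ('a \<Rightarrow> 'b) \<Rightarrow> 'a list \<Rightarrow> 'b list \<Rightarrow> bool" where
  "odd_path_image S f p q \<longleftrightarrow> is_path S q \<and> even (length q) \<and> 4 \<le> length q \<and>
     hd q = f (hd p) \<and> last q = f (last p) \<and> path_interior q \<subseteq> f ` path_interior p"

lemma odd_path_image_map:
  assumes "is_path S (map f p)" "even (length p)" "4 \<le> length p"
  shows "odd_path_image S f p (map f p)"
proof -
  have "path_interior (map f p) = f ` path_interior p"
    by (simp add: path_interior_def map_butlast map_tl flip: set_map)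
  moreover have "p \<noteq> []" using assms(3) by auto
  ultimately show ?thesis
    using assms by (simp add: odd_path_image_def hd_map last_map)
qed


section \<open>Shrinking one side of a 2-join\<close>

text \<open>\<open>\<phi>\<close> collapses the second side onto the markers: \<open>A2\<close>, \<open>B2\<close>, \<open>C2\<close> go to \<open>a\<close>, \<open>b\<close>, \<open>c\<close>. The flag
  \<open>od\<close> records whether the 2-join is odd, in which case \<open>c\<close> is not a vertex of \<open>S\<close>. The markers
  are parameters, so that the roles of \<open>A\<close> and \<open>B\<close> can be exchanged.\<close>

locale two_join_block =
  fixes T :: "'a trigraph" and A1 B1 C1 A2 B2 C2 :: "'a set"
    and S :: "'b trigraph" and \<phi> :: "'a \<Rightarrow> 'b" and a b c :: 'b and od :: bool
  assumes wf_T: "wf_trigraph T" and berge_T: "berge T" and wf_S: "wf_trigraph S"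
    and verts_T: "verts T = (A1 \<union> B1 \<union> C1) \<union> (A2 \<union> B2 \<union> C2)"
    and sides_disjoint: "(A1 \<union> B1 \<union> C1) \<inter> (A2 \<union> B2 \<union> C2) = {}"
    and disjoint1: "A1 \<inter> B1 = {}" "A1 \<inter> C1 = {}" "B1 \<inter> C1 = {}"
    and disjoint2: "A2 \<inter> B2 = {}" "A2 \<inter> C2 = {}" "B2 \<inter> C2 = {}"
    and nonempty1: "A1 \<noteq> {}" "B1 \<noteq> {}" and nonempty2: "A2 \<noteq> {}" "B2 \<noteq> {}"
    and theta_cross: "\<And>u v. u \<in> A1 \<union> B1 \<union> C1 \<Longrightarrow> v \<in> A2 \<union> B2 \<union> C2 \<Longrightarrow>
          theta T u v = (if u \<in> A1 \<and> v \<in> A2 \<or> u \<in> B1 \<and> v \<in> B2 then 1 else -1)"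
    and parity: "\<And>p. side_path T A2 B2 C2 p \<Longrightarrow> odd (path_length p) \<longleftrightarrow> od"
    and verts_S: "verts S = \<phi> ` (A1 \<union> B1 \<union> C1) \<union> {a, b} \<union> (if od then {} else {c})"
    and inj_\<phi>: "inj_on \<phi> (A1 \<union> B1 \<union> C1)"
    and markers_new: "a \<notin> \<phi> ` (A1 \<union> B1 \<union> C1)" "b \<notin> \<phi> ` (A1 \<union> B1 \<union> C1)" "c \<notin> \<phi> ` (A1 \<union> B1 \<union> C1)"
    and markers_distinct: "a \<noteq> b" "a \<noteq> c" "b \<noteq> c"
    and \<phi>_2: "\<And>u. u \<in> A2 \<Longrightarrow> \<phi> u = a" "\<And>u. u \<in> B2 \<Longrightarrow> \<phi> u = b" "\<And>u. u \<in> C2 \<Longrightarrow> \<phi> u = c"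
    and theta_\<phi>: "\<And>u v. u \<in> A1 \<union> B1 \<union> C1 \<Longrightarrow> v \<in> A1 \<union> B1 \<union> C1 \<Longrightarrow> u \<noteq> v \<Longrightarrow>
          theta S (\<phi> u) (\<phi> v) = theta T u v"
    and theta_\<phi>_a: "\<And>u. u \<in> A1 \<union> B1 \<union> C1 \<Longrightarrow> theta S (\<phi> u) a = (if u \<in> A1 then 1 else -1)"
    and theta_\<phi>_b: "\<And>u. u \<in> A1 \<union> B1 \<union> C1 \<Longrightarrow> theta S (\<phi> u) b = (if u \<in> B1 then 1 else -1)"
    and theta_\<phi>_c: "\<And>u. \<not> od \<Longrightarrow> u \<in> A1 \<union> B1 \<union> C1 \<Longrightarrow> theta S (\<phi> u) c = -1"
    and theta_a_b: "theta S a b = (if od then 0 else -1)"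
    and theta_a_c: "\<not> od \<Longrightarrow> theta S a c = 0"
    and theta_b_c: "\<not> od \<Longrightarrow> theta S b c = 0"
begin

section \<open>Symmetries of the setting and the two sides\<close>

definition X1 where "X1 = A1 \<union> B1 \<union> C1"
definition X2 where "X2 = A2 \<union> B2 \<union> C2"

lemma theta_T_sym: "u \<in> verts T \<Longrightarrow> v \<in> verts T \<Longrightarrow> u \<noteq> v \<Longrightarrow> theta T u v = theta T v u"
  using wf_T unfolding wf_trigraph_def by metis

lemma theta_S_sym: "u \<in> verts S \<Longrightarrow> v \<in> verts S \<Longrightarrow> u \<noteq> v \<Longrightarrow> theta S u v = theta S v u"
  using wf_S unfolding wf_trigraph_def by metis

text \<open>\<open>parity\<close> speaks of paths from \<open>A2\<close> to \<open>B2\<close>;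
  reversal supplies its instance with the two exchanged.\<close>

lemma side_path_swap:
  assumes "side_path T B2 A2 C2 p"
  shows "side_path T A2 B2 C2 (rev p)"
proof -
  have p: "is_path T p" "hd p \<in> B2" "last p \<in> A2" "path_interior p \<subseteq> C2"
    using assms by (auto simp: side_path_def)
  then have "p \<noteq> []" by (auto simp: is_path_def)
  then show ?thesis
    using p is_path_rev[OF wf_T p(1)] by (simp add: side_path_def path_interior_rev hd_rev last_rev)
qed

lemma swap: "two_join_block T B1 A1 C1 B2 A2 C2 S \<phi> b a c od"
proof -
  have ba: "theta S b a = (if od then 0 else -1)"
    using theta_S_sym[of a b] theta_a_b markers_distinct by (simp add: verts_S)
  have par: "odd (path_length p) \<longleftrightarrow> od" if "side_path T B2 A2 C2 p" for p
    using parity[OF side_path_swap[OF that]] by (simp add: path_length_def)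
  have tc: "theta T u v = (if u \<in> B1 \<and> v \<in> B2 \<or> u \<in> A1 \<and> v \<in> A2 then 1 else -1)"
    if "u \<in> A1 \<union> B1 \<union> C1" "v \<in> A2 \<union> B2 \<union> C2" for u v
    using theta_cross[OF that] by (simp only: disj_commute)
  have vs: "verts S = \<phi> ` (A1 \<union> B1 \<union> C1) \<union> {b, a} \<union> (if od then {} else {c})"
    unfolding verts_S by (simp only: insert_commute)
  have dj: "B1 \<inter> A1 = {}" "B2 \<inter> A2 = {}" "b \<noteq> a"
    using disjoint1 disjoint2 markers_distinct by auto
  note un = Un_commute[of B1 A1] Un_commute[of B2 A2]
  show ?thesis
    by (rule two_join_block.intro; (unfold un)?;
        fact wf_T berge_T wf_S verts_T sides_disjoint disjoint1 disjoint2 dj nonempty1 nonempty2 inj_\<phi>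
          markers_new markers_distinct \<phi>_2 theta_\<phi> theta_\<phi>_a theta_\<phi>_b theta_\<phi>_c theta_a_c
          theta_b_c ba par tc vs)
qed

lemma X_facts:
  "u \<in> A1 \<Longrightarrow> u \<in> X1" "u \<in> B1 \<Longrightarrow> u \<in> X1" "u \<in> A2 \<Longrightarrow> u \<in> X2" "u \<in> B2 \<Longrightarrow> u \<in> X2"
  "u \<in> C2 \<Longrightarrow> u \<in> X2" "u \<in> X1 \<Longrightarrow> u \<notin> X2" "u \<in> A1 \<Longrightarrow> u \<notin> B1" "u \<in> A2 \<Longrightarrow> u \<notin> B2"
  "u \<in> A2 \<Longrightarrow> u \<notin> C2" "u \<in> B2 \<Longrightarrow> u \<notin> C2"
  using sides_disjoint disjoint1 disjoint2 by (auto simp: X1_def X2_def)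

lemma verts_T_iff: "u \<in> verts T \<longleftrightarrow> u \<in> X1 \<or> u \<in> X2"
  by (auto simp: verts_T X1_def X2_def)

lemma X2_iff: "u \<in> X2 \<longleftrightarrow> u \<in> A2 \<or> u \<in> B2 \<or> u \<in> C2"
  by (auto simp: X2_def)

section \<open>Adjacency across the 2-join\<close>

definition joined :: "'a \<Rightarrow> 'a \<Rightarrow> bool" where
  "joined u v \<longleftrightarrow> u \<in> A1 \<and> v \<in> A2 \<or> u \<in> B1 \<and> v \<in> B2"

text \<open>No pair across the join is switchable, so one relation decides adjacency and its
  negation decides antiadjacency.\<close>

lemma cross:
  assumes "u \<in> X1" "v \<in> X2"
  shows "adjacent T u v \<longleftrightarrow> joined u v" "antiadjacent T u v \<longleftrightarrow> \<not> joined u v"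
    "adjacent T v u \<longleftrightarrow> joined u v" "antiadjacent T v u \<longleftrightarrow> \<not> joined u v"
proof -
  have uv: "u \<in> verts T" "v \<in> verts T" "u \<noteq> v" using assms X_facts by (auto simp: verts_T_iff)
  have "theta T u v = (if joined u v then 1 else -1)"
    using theta_cross assms unfolding X1_def X2_def joined_def by blast
  then show "adjacent T u v \<longleftrightarrow> joined u v" "antiadjacent T u v \<longleftrightarrow> \<not> joined u v"
    "adjacent T v u \<longleftrightarrow> joined u v" "antiadjacent T v u \<longleftrightarrow> \<not> joined u v"
    using uv theta_T_sym[of u v] by (auto simp: adjacent_def antiadjacent_def)
qed

text \<open>On a path adjacency alone does not make two vertices consecutive, since a switchable
  pair may serve as a non-consecutive one. Across the join this cannot happen, so adjacency can be
  read off the positions.\<close>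

lemma path_cross:
  assumes p: "is_path T p" and "i < length p" "j < length p" "p ! i \<in> X1" "p ! j \<in> X2"
  shows "joined (p ! i) (p ! j) \<longleftrightarrow> i = Suc j \<or> j = Suc i"
proof -
  note cr = cross[OF assms(4,5)]
  have "i \<noteq> j" using assms(4,5) X_facts(6) by auto
  then consider "i = Suc j" | "j = Suc i" | "Suc i < j" | "Suc j < i" by linarith
  then show ?thesis
    using path_nth_adjacent[OF p] path_nth_antiadjacent[OF p] cr assms(2,3) by cases auto
qed

lemma antipath_cross:
  assumes p: "is_antipath T p" and "i < length p" "j < length p" "p ! i \<in> X1" "p ! j \<in> X2"
  shows "joined (p ! i) (p ! j) \<longleftrightarrow> i \<noteq> Suc j \<and> j \<noteq> Suc i"
proof -
  note cr = cross[OF assms(4,5)] and p' = p[unfolded is_antipath_def]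
  have "i \<noteq> j" using assms(4,5) X_facts(6) by auto
  then consider "i = Suc j" | "j = Suc i" | "Suc i < j" | "Suc j < i" by linarith
  then show ?thesis
    using path_nth_adjacent[OF p'] path_nth_antiadjacent[OF p'] cr assms(2,3) by cases auto
qed

text \<open>Such an edge would be a side path of length one. The even block makes \<open>a\<close>
  and \<open>b\<close> strongly antiadjacent, so \<open>\<phi>\<close> could not preserve
  it.\<close>

lemma not_adjacent_A2_B2:
  assumes "\<not> od" "u \<in> A2" "v \<in> B2"
  shows "\<not> adjacent T u v"
proof
  assume "adjacent T u v"
  then have "side_path T A2 B2 C2 [u, v]"
    using assms by (auto simp: side_path_def path_interior_def intro!: is_pathI)
  then show False using parity[of "[u, v]"] assms(1) by (simp add: path_length_def)
qed

section \<open>The collapsing map on pairs of vertices\<close>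

lemma \<phi>_in_verts:
  "u \<in> verts T \<Longrightarrow> (u \<in> C2 \<Longrightarrow> \<not> od) \<Longrightarrow> \<phi> u \<in> verts S"
  by (auto simp: verts_T verts_S \<phi>_2)

lemma \<phi>_X1: "u \<in> X1 \<Longrightarrow> \<phi> u \<noteq> a \<and> \<phi> u \<noteq> b \<and> \<phi> u \<noteq> c"
  using markers_new unfolding X1_def by blast

lemma \<phi>_pair:
  assumes "u \<in> verts T" "v \<in> verts T" "u \<noteq> v" "\<not> (u \<in> A2 \<and> v \<in> A2)" "\<not> (u \<in> B2 \<and> v \<in> B2)"
    "\<not> (u \<in> C2 \<and> v \<in> C2)" "u \<in> C2 \<or> v \<in> C2 \<Longrightarrow> \<not> od"
  shows "\<phi> u \<noteq> \<phi> v" "theta S (\<phi> u) (\<phi> v) = theta T u v \<or> theta S (\<phi> u) (\<phi> v) = 0 \<or>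
      theta S (\<phi> u) (\<phi> v) = -1 \<and> \<not> od \<and> (u \<in> A2 \<and> v \<in> B2 \<or> u \<in> B2 \<and> v \<in> A2)"
proof -
  define Q where "Q u v \<longleftrightarrow> \<phi> u \<noteq> \<phi> v \<and> (theta S (\<phi> u) (\<phi> v) = theta T u v \<or> theta S (\<phi> u) (\<phi> v) = 0 \<or>
      theta S (\<phi> u) (\<phi> v) = -1 \<and> \<not> od \<and> (u \<in> A2 \<and> v \<in> B2 \<or> u \<in> B2 \<and> v \<in> A2))" for u v
  have sym: "Q u v" if "Q v u" 
    using that unfolding Q_def using theta_T_sym[OF assms(1-3)] theta_S_sym[of "\<phi> u" "\<phi> v"] \<phi>_in_verts assms by metis
  have 11: "Q u v" if "u \<in> X1" "v \<in> X1"
    using that theta_\<phi>[of u v] inj_onD[OF inj_\<phi>, of u v] assms(3) unfolding X1_def Q_def by blast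
  have 12: "Q u v" if "u \<in> X1" "v \<in> X2" "v \<in> C2 \<Longrightarrow> \<not> od" for u v
  proof -
    have "\<phi> u \<noteq> \<phi> v" using that \<phi>_X1[of u] \<phi>_2[of v] by (auto simp: X2_iff)
    moreover have "theta S (\<phi> u) (\<phi> v) = theta T u v"
      using that theta_cross[of u v] theta_\<phi>_a[of u] theta_\<phi>_b[of u] theta_\<phi>_c[of u] \<phi>_2[of v]
        X_facts[of v] by (auto simp: X2_def X1_def)
    ultimately show ?thesis by (simp add: Q_def)
  qed
  have AB: "Q u v" if "u \<in> A2" "v \<in> B2" for u v
    using that theta_a_b \<phi>_2 markers_distinct by (auto simp: Q_def)
  have AC: "Q u v" if "u \<in> A2 \<or> u \<in> B2" "v \<in> C2" "\<not> od" for u v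
    using that theta_a_c theta_b_c \<phi>_2 markers_distinct by (auto simp: Q_def)
  have "Q u v"
    using sym 11 12[of u v] 12[of v u] AB[of u v] AB[of v u] AC[of u v] AC[of v u] assms
    unfolding verts_T_iff X2_iff by blast
  then show "\<phi> u \<noteq> \<phi> v" "theta S (\<phi> u) (\<phi> v) = theta T u v \<or> theta S (\<phi> u) (\<phi> v) = 0 \<or>
      theta S (\<phi> u) (\<phi> v) = -1 \<and> \<not> od \<and> (u \<in> A2 \<and> v \<in> B2 \<or> u \<in> B2 \<and> v \<in> A2)" by (auto simp: Q_def)
qed

lemma \<phi>_adjacent:
  assumes "adjacent T u v" "\<not> (u \<in> A2 \<and> v \<in> A2)" "\<not> (u \<in> B2 \<and> v \<in> B2)"
    "\<not> (u \<in> C2 \<and> v \<in> C2)" "u \<in> C2 \<or> v \<in> C2 \<Longrightarrow> \<not> od"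
  shows "adjacent S (\<phi> u) (\<phi> v)"
proof -
  have uv: "u \<in> verts T" "v \<in> verts T" "u \<noteq> v" "theta T u v \<in> {0, 1}"
    using assms(1) by (auto simp: adjacent_def)
  have "\<not> (\<not> od \<and> (u \<in> A2 \<and> v \<in> B2 \<or> u \<in> B2 \<and> v \<in> A2))"
    using assms(1) adjacent_sym[OF wf_T assms(1)] not_adjacent_A2_B2 by blast
  then show ?thesis
    using \<phi>_pair[OF uv(1-3) assms(2-5)] uv \<phi>_in_verts[of u] \<phi>_in_verts[of v] assms(5)
    by (auto simp: adjacent_def)
qed

lemma \<phi>_antiadjacent:
  assumes "antiadjacent T u v" "\<not> (u \<in> A2 \<and> v \<in> A2)" "\<not> (u \<in> B2 \<and> v \<in> B2)"
    "\<not> (u \<in> C2 \<and> v \<in> C2)" "u \<in> C2 \<or> v \<in> C2 \<Longrightarrow> \<not> od"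
  shows "antiadjacent S (\<phi> u) (\<phi> v)"
proof -
  have uv: "u \<in> verts T" "v \<in> verts T" "u \<noteq> v" "theta T u v \<in> {-1, 0}"
    using assms(1) by (auto simp: antiadjacent_def)
  then show ?thesis
    using \<phi>_pair[OF uv(1-3) assms(2-5)] \<phi>_in_verts[of u] \<phi>_in_verts[of v] assms(5)
    by (auto simp: antiadjacent_def)
qed

text \<open>\<open>\<phi>\<close> never raises a value to 1, and a collapsed pair has a single
  image, so strong adjacency in \<open>S\<close> can only come from strong adjacency in
  \<open>T\<close>.\<close>

lemma strongly_adjacent_\<phi>_D:
  assumes "u \<in> verts T" "v \<in> verts T" "strongly_adjacent S (\<phi> u) (\<phi> v)"
  shows "strongly_adjacent T u v"
proof -
  have S: "\<phi> u \<in> verts S" "\<phi> v \<in> verts S" "\<phi> u \<noteq> \<phi> v" "theta S (\<phi> u) (\<phi> v) = 1"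
    using assms(3) by (auto simp: strongly_adjacent_def)
  have "c \<notin> verts S" if od using that markers_new(3) markers_distinct by (auto simp: verts_S)
  then have "u \<in> C2 \<or> v \<in> C2 \<Longrightarrow> \<not> od" using S(1,2) \<phi>_2(3) by metis
  moreover have "\<not> (u \<in> A2 \<and> v \<in> A2)" "\<not> (u \<in> B2 \<and> v \<in> B2)" "\<not> (u \<in> C2 \<and> v \<in> C2)" "u \<noteq> v"
    using S(3) \<phi>_2 by auto
  ultimately have "theta T u v = 1" using \<phi>_pair(2)[OF assms(1,2)] S(4) by auto
  then show ?thesis using assms(1,2) \<open>u \<noteq> v\<close> by (simp add: strongly_adjacent_def)
qed

text \<open>For \<open>U\<close> inside \<open>verts T\<close> this says that \<open>\<phi>\<close>
  is injective on \<open>U\<close> and maps it into \<open>verts S\<close>.\<close>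

definition separated :: "'a set \<Rightarrow> bool" where
  "separated U \<longleftrightarrow> (\<forall>u\<in>U. \<forall>v\<in>U. u \<noteq> v \<longrightarrow>
     \<not> (u \<in> A2 \<and> v \<in> A2) \<and> \<not> (u \<in> B2 \<and> v \<in> B2) \<and> \<not> (u \<in> C2 \<and> v \<in> C2)) \<and>
   (U \<inter> C2 \<noteq> {} \<longrightarrow> \<not> od)"

lemma separated_adjacent:
  assumes "separated U" "u \<in> U" "v \<in> U"
  shows "adjacent T u v \<Longrightarrow> adjacent S (\<phi> u) (\<phi> v)"
    and "antiadjacent T u v \<Longrightarrow> antiadjacent S (\<phi> u) (\<phi> v)"
proof -
  have sep: "\<not> (u \<in> A2 \<and> v \<in> A2)" "\<not> (u \<in> B2 \<and> v \<in> B2)" "\<not> (u \<in> C2 \<and> v \<in> C2)" if "u \<noteq> v"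
    using that assms unfolding separated_def by blast+
  have C2: "u \<in> C2 \<or> v \<in> C2 \<Longrightarrow> \<not> od" using assms unfolding separated_def by blast
  show "adjacent S (\<phi> u) (\<phi> v)" if uv: "adjacent T u v"
  proof -
    have "u \<noteq> v" using uv by (simp add: adjacent_def)
    then show ?thesis using \<phi>_adjacent[OF uv] sep C2 by blast
  qed
  show "antiadjacent S (\<phi> u) (\<phi> v)" if uv: "antiadjacent T u v"
  proof -
    have "u \<noteq> v" using uv by (simp add: antiadjacent_def)
    then show ?thesis using \<phi>_antiadjacent[OF uv] sep C2 by blast
  qed
qed

lemma separatedI_nth:
  assumes "\<And>k l. k < length p \<Longrightarrow> l < length p \<Longrightarrow> p ! k \<in> A2 \<Longrightarrow> p ! l \<in> A2 \<Longrightarrow> k = l"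
    and "\<And>k l. k < length p \<Longrightarrow> l < length p \<Longrightarrow> p ! k \<in> B2 \<Longrightarrow> p ! l \<in> B2 \<Longrightarrow> k = l"
    and "\<And>k l. k < length p \<Longrightarrow> l < length p \<Longrightarrow> p ! k \<in> C2 \<Longrightarrow> p ! l \<in> C2 \<Longrightarrow> k = l"
    and "\<And>k. k < length p \<Longrightarrow> p ! k \<in> C2 \<Longrightarrow> \<not> od"
  shows "separated (set p)"
  unfolding separated_def
proof (intro conjI ballI impI)
  fix u v assume "u \<in> set p" "v \<in> set p" and ne: "u \<noteq> v"
  then obtain k l where kl: "k < length p" "l < length p" "u = p ! k" "v = p ! l"
    by (metis in_set_conv_nth)
  show "\<not> (u \<in> A2 \<and> v \<in> A2)" "\<not> (u \<in> B2 \<and> v \<in> B2)" "\<not> (u \<in> C2 \<and> v \<in> C2)"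
    using ne assms(1-3)[OF kl(1,2)] unfolding kl(3,4) by blast+
next
  assume "set p \<inter> C2 \<noteq> {}"
  then obtain k where "k < length p" "p ! k \<in> C2" by (metis disjoint_iff in_set_conv_nth)
  then show "\<not> od" using assms(4) by blast
qed

section \<open>How a path meets \<open>A2\<close> and \<open>B2\<close>\<close>

lemma path_enters_X2:
  assumes p: "is_path T p" and "p ! 0 \<in> X1" "l < length p" "p ! l \<in> X2"
  obtains m where "Suc m \<le> l" "p ! m \<in> X1" "p ! Suc m \<in> X2" "joined (p ! m) (p ! Suc m)"
    "\<forall>k\<le>m. p ! k \<in> X1"
proof -
  define i where "i = (LEAST i. p ! i \<in> X2)"
  have i: "p ! i \<in> X2" "i \<le> l" and min: "\<And>k. k < i \<Longrightarrow> p ! k \<notin> X2"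
    unfolding i_def using assms(4) by (auto intro: LeastI Least_le dest: not_less_Least)
  have "i \<noteq> 0" using i(1) assms(2) X_facts(6) by metis
  then obtain m where m: "i = Suc m" by (cases i) auto
  have X1: "\<forall>k\<le>m. p ! k \<in> X1"
  proof (intro allI impI)
    fix k assume "k \<le> m"
    then have "k < i" "k < length p" using m i(2) assms(3) by auto
    then show "p ! k \<in> X1" using min path_nth_verts[OF p] verts_T_iff by blast
  qed
  have "joined (p ! m) (p ! Suc m)"
    using path_cross[OF p, of m "Suc m"] X1 i m assms(3) by auto
  then show ?thesis using that[of m] X1 i m by blast
qed

lemma path_leaves_X2:
  assumes p: "is_path T p" and "p ! (length p - 1) \<in> X1" "l < length p" "p ! l \<in> X2"
  obtains m where "l \<le> m" "Suc m < length p" "p ! m \<in> X2" "p ! Suc m \<in> X1"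
    "joined (p ! Suc m) (p ! m)" "\<forall>k. m < k \<and> k < length p \<longrightarrow> p ! k \<in> X1"
proof -
  let ?P = "\<lambda>i. i < length p \<and> p ! i \<in> X2"
  define m where "m = (GREATEST i. ?P i)"
  have Pm: "?P m" unfolding m_def by (rule GreatestI_nat[of ?P l "length p"]) (use assms in auto)
  have max: "k \<le> m" if "?P k" for k
    unfolding m_def by (rule Greatest_le_nat[of ?P k "length p"]) (use that in auto)
  have "m \<noteq> length p - 1" using Pm assms(2) X_facts(6) by metis
  then have m: "Suc m < length p" using Pm by linarith
  have X1: "\<forall>k. m < k \<and> k < length p \<longrightarrow> p ! k \<in> X1"
    using max path_nth_verts[OF p] verts_T_iff by (meson linorder_not_less)
  have "joined (p ! Suc m) (p ! m)"
    using path_cross[OF p, of "Suc m" m] X1 Pm m by auto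
  then show ?thesis using that[of m] max[of l] assms X1 m Pm by auto
qed

lemma joined_A2: "joined u v \<Longrightarrow> v \<in> A2 \<Longrightarrow> w \<in> A2 \<Longrightarrow> joined u w"
  and joined_B2: "joined u v \<Longrightarrow> v \<in> B2 \<Longrightarrow> w \<in> B2 \<Longrightarrow> joined u w"
  and joined_X2: "joined u v \<Longrightarrow> v \<in> A2 \<or> v \<in> B2"
  using X_facts by (auto simp: joined_def)

text \<open>\<open>X1\<close> depends on the locale parameters, so the exchanged instance has its
  own copy, which must be identified with this one before the lemmas of both can be
  combined.\<close>

lemma X1_swap: "two_join_block.X1 B1 A1 C1 = X1"
  unfolding X1_def two_join_block.X1_def[OF swap] by (rule Un_commute[THEN arg_cong])

text \<open>The vertex before the entry sees all of \<open>A2\<close>, so a vertex of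
  \<open>A2\<close> on the path must be next to it; before it there is only the first side.\<close>

lemma path_A2_after_entry:
  assumes p: "is_path T p" and m: "p ! m \<in> X1" "joined (p ! m) (p ! Suc m)" "p ! Suc m \<in> A2"
      "\<forall>k\<le>m. p ! k \<in> X1"
    and k: "k < length p" "p ! k \<in> A2"
  shows "k = Suc m"
proof -
  have "m < k" using m(4) k(2) X_facts(3,6) by (meson linorder_not_less)
  moreover have "joined (p ! m) (p ! k)" using joined_A2[OF m(2,3) k(2)] .
  ultimately show ?thesis using path_cross[OF p _ k(1) m(1)] k X_facts(3) by force
qed

text \<open>If the path first enters or finally leaves \<open>X2\<close> through \<open>A2\<close>,
  the neighbouring vertex of \<open>X1\<close> sees all of \<open>A2\<close>, which leaves room for
  one vertex of \<open>A2\<close> only. Otherwise both passages use \<open>B2\<close>; the vertex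
  before the entry sees the exit too, so entry and exit coincide and \<open>A2\<close> is not met at
  all.\<close>

lemma path_unique_A2:
  assumes p: "is_path T p" and ends: "p ! 0 \<in> X1" "p ! (length p - 1) \<in> X1"
    and ij: "i < length p" "p ! i \<in> A2" "j < length p" "p ! j \<in> A2"
  shows "i = j"
proof -
  have X2: "p ! i \<in> X2" "p ! j \<in> X2" using ij X_facts by auto
  obtain m where m: "Suc m \<le> i" "p ! m \<in> X1" "p ! Suc m \<in> X2" "joined (p ! m) (p ! Suc m)"
    "\<forall>k\<le>m. p ! k \<in> X1"
    using path_enters_X2[OF p ends(1) ij(1) X2(1)] .
  obtain n where n: "i \<le> n" "Suc n < length p" "p ! n \<in> X2" "p ! Suc n \<in> X1"
    "joined (p ! Suc n) (p ! n)" "\<forall>k. n < k \<and> k < length p \<longrightarrow> p ! k \<in> X1"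
    using path_leaves_X2[OF p ends(2) ij(1) X2(1)] .
  have lm: "m < k" and ln: "k \<le> n" if "k < length p" "p ! k \<in> X2" for k
    using m(5) n(6) that X_facts(6) by (meson linorder_not_less)+
  have len: "m < length p" "Suc m < length p" "n < length p" using m n by auto
  show ?thesis
  proof (cases "p ! Suc m \<in> A2")
    case True
    then show ?thesis using path_A2_after_entry[OF p m(2,4) True m(5)] ij by metis
  next
    case F1: False
    show ?thesis
    proof (cases "p ! n \<in> A2")
      case True
      then have "k = n" if "k < length p" "p ! k \<in> A2" for k
        using path_cross[OF p n(2) that(1) n(4)] joined_A2[OF n(5)] that ln[OF that(1)] X_facts(3)
        by (metis Suc_n_not_le_n le_SucI nat.inject)
      then show ?thesis using ij by metis
    next
      case False
      then have "joined (p ! m) (p ! n)"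
        using F1 joined_X2[OF m(4)] joined_X2[OF n(5)] joined_B2[OF m(4)] by blast
      then have "n = Suc m"
        using path_cross[OF p len(1,3) m(2) n(3)] lm[OF len(3) n(3)] by auto
      then have "i = n" using m(1) n(1) by simp
      then show ?thesis using False ij by simp
    qed
  qed
qed

lemma path_unique_B2:
  assumes "is_path T p" "p ! 0 \<in> X1" "p ! (length p - 1) \<in> X1"
    and "i < length p" "p ! i \<in> B2" "j < length p" "p ! j \<in> B2"
  shows "i = j"
  using two_join_block.path_unique_A2[OF swap, unfolded X1_swap] assms by blast

section \<open>Runs inside \<open>C2\<close>, their contraction, and odd paths\<close>

lemma C2_run:
  assumes p: "is_path T p" and ends: "p ! 0 \<notin> C2" "p ! (length p - 1) \<notin> C2"
    and l: "l < length p" "p ! l \<in> C2"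
  obtains i j where "i < l" "l < j" "j < length p" "\<forall>k. i < k \<and> k < j \<longrightarrow> p ! k \<in> C2"
    "p ! i \<in> A2 \<union> B2" "p ! j \<in> A2 \<union> B2"
proof -
  let ?P = "\<lambda>i. i < l \<and> p ! i \<notin> C2"
  define i where "i = (GREATEST i. ?P i)"
  have "0 < l" using ends(1) l by (metis neq0_conv)
  have i: "?P i" unfolding i_def by (rule GreatestI_nat[of ?P 0 l]) (use \<open>0 < l\<close> ends in auto)
  have imax: "k \<le> i" if "?P k" for k
    unfolding i_def by (rule Greatest_le_nat[of ?P k l]) (use that in auto)
  let ?Q = "\<lambda>j. l < j \<and> p ! j \<notin> C2"
  define j where "j = (LEAST j. ?Q j)"
  have "l \<noteq> length p - 1" using ends(2) l by metis
  then have Ql: "?Q (length p - 1)" using ends(2) l by auto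
  have j: "?Q j" unfolding j_def by (rule LeastI[of ?Q, OF Ql])
  have "j \<le> length p - 1" unfolding j_def by (rule Least_le[of ?Q, OF Ql])
  then have jl: "j < length p" using l by linarith
  have jmin: "j \<le> k" if "?Q k" for k unfolding j_def using that by (rule Least_le)
  have run: "\<forall>k. i < k \<and> k < j \<longrightarrow> p ! k \<in> C2"
    using imax jmin l by (metis linorder_not_less linorder_neqE_nat)
  \<comment> \<open>A path neighbour of a \<open>C2\<close> vertex cannot lie in \<open>X1\<close>,
    because no vertex of \<open>C2\<close> is joined to the first side.\<close>
  have bound: "p ! k \<in> A2 \<union> B2"
    if "k < length p" "k' < length p" "p ! k \<notin> C2" "p ! k' \<in> C2" "k = Suc k' \<or> k' = Suc k" for k k'
  proof (rule ccontr)
    assume "p ! k \<notin> A2 \<union> B2"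
    then have "p ! k \<in> X1"
      using path_nth_verts[OF p that(1)] that(3) unfolding verts_T_iff X2_iff by blast
    then have "joined (p ! k) (p ! k')" using path_cross[OF p that(1,2)] that X_facts(5) by blast
    then show False using joined_X2 that(4) X_facts by blast
  qed
  have "p ! i \<in> A2 \<union> B2" using bound[of i "Suc i"] run i j jl by auto
  moreover have "p ! j \<in> A2 \<union> B2"
    using bound[of j "j - 1"] run i j jl by auto
  ultimately show ?thesis using that[of i j] i j jl run by blast
qed

lemma segment_parity:
  assumes p: "is_path T p" and ij: "i < j" "j < length p" "p ! i \<in> A2" "p ! j \<in> B2"
    and run: "\<forall>k. i < k \<and> k < j \<longrightarrow> p ! k \<in> C2"
  shows "odd (j - i) \<longleftrightarrow> od"
proof -
  let ?s = "map ((!) p) [i..<Suc j]"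
  have len: "length ?s = Suc j - i" by (simp del: upt_Suc)
  have "path_interior ?s \<subseteq> C2"
  proof
    fix x assume "x \<in> path_interior ?s"
    then obtain k where "0 < k" "k < length ?s - 1" "x = ?s ! k" using path_interior_conv by metis
    then show "x \<in> C2" using run len by (auto simp del: upt_Suc)
  qed
  then have "side_path T A2 B2 C2 ?s"
    using is_path_segment[OF p ij(1,2)] ij
    by (auto simp: side_path_def hd_map hd_upt last_map simp del: upt_Suc)
  then show "odd (j - i) \<longleftrightarrow> od"
    using parity[of ?s] len ij(1) unfolding path_length_def by (metis Suc_diff_le diff_Suc_1 less_imp_le)
qed

text \<open>The stretch from \<open>A2\<close> to \<open>B2\<close> becomes \<open>a\<close>,
  \<open>b\<close> if the join is odd and \<open>a\<close>, \<open>c\<close>, \<open>b\<close> if it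
  is even. The stretch is a side path, so its length has the parity of its replacement, and the
  number of vertices drops by an even amount.\<close>

lemma contract_side_path:
  assumes p: "is_path T p" "even (length p)" "p ! 0 \<in> X1"
    and uniq: "\<And>k l. k < length p \<Longrightarrow> l < length p \<Longrightarrow> p ! k \<in> A2 \<Longrightarrow> p ! l \<in> A2 \<Longrightarrow> k = l"
      "\<And>k l. k < length p \<Longrightarrow> l < length p \<Longrightarrow> p ! k \<in> B2 \<Longrightarrow> p ! l \<in> B2 \<Longrightarrow> k = l"
    and ij: "i < j" "j < length p" "p ! i \<in> A2" "p ! j \<in> B2"
    and run: "\<forall>k. i < k \<and> k < j \<longrightarrow> p ! k \<in> C2"
    and C2: "\<And>k. k < length p \<Longrightarrow> p ! k \<in> C2 \<Longrightarrow> i < k \<and> k < j"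
  shows "\<exists>q. odd_path_image S \<phi> p q"
proof -
  have par: "odd (j - i) \<longleftrightarrow> od" using segment_parity[OF p(1) ij run] .
  have i0: "0 < i" using p(3) ij(3) X_facts by (metis neq0_conv)
  \<comment> \<open>The kept prefix ends just before \<open>t\<close>: at \<open>p ! i\<close> or,
    in the even case, at \<open>p ! Suc i\<close>, a vertex of \<open>C2\<close> that becomes
    \<open>c\<close>. The \<open>j - t\<close> positions from \<open>t\<close> on are dropped;
    \<open>g\<close> skips them.\<close>
  define t where "t = (if od then Suc i else Suc (Suc i))"
  have tj: "t \<le> j" "even (j - t)" "i < t"
    using par ij(1) by (auto simp: t_def Suc_le_eq intro!: Suc_lessI)
  define g where "g k = (if k < t then k else k - t + j)" for k
  define n where "n = t + (length p - j)"
  define q where "q = map (\<lambda>k. \<phi> (p ! g k)) [0..<n]"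
  have lq: "length q = n" by (simp add: q_def)
  have qn: "q ! k = \<phi> (p ! g k)" if "k < n" for k using that by (simp add: q_def)
  have gl: "g k < length p" if "k < n" for k using that tj ij by (auto simp: g_def n_def)
  have gC2: "\<not> od \<and> g k = Suc i" if "k < n" "p ! g k \<in> C2" for k
    using C2[OF gl[OF that(1)] that(2)] by (auto simp: g_def t_def split: if_splits)
  have gadj: "g k < g l" "Suc k < l \<Longrightarrow> Suc (g k) < g l" if "k < l" for k l
    using that tj by (auto simp: g_def)
  have sep: "\<not> (p ! g k \<in> A2 \<and> p ! g l \<in> A2)" "\<not> (p ! g k \<in> B2 \<and> p ! g l \<in> B2)"
      "\<not> (p ! g k \<in> C2 \<and> p ! g l \<in> C2)" "p ! g k \<in> C2 \<or> p ! g l \<in> C2 \<Longrightarrow> \<not> od"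
    if "k < l" "l < n" for k l
    using uniq[of "g k" "g l"] gl[of k] gl[of l] gC2[of k] gC2[of l] gadj(1)[OF that(1)] that by auto
  have "is_path S q"
  proof (rule is_pathI)
    show "2 \<le> length q" using tj i0 unfolding lq n_def by simp
  next
    fix k assume "Suc k < length q"
    then have k: "Suc k < n" by (simp add: lq)
    \<comment> \<open>Only the jump over the dropped positions joins vertices that need not be
      consecutive on \<open>p\<close>; there the switchable pair \<open>ab\<close> or
      \<open>cb\<close> serves as the edge.\<close>
    show "adjacent S (q ! k) (q ! Suc k)"
    proof (cases "Suc k = t")
      case False
      then have "g (Suc k) = Suc (g k)" by (auto simp: g_def)
      then have "adjacent T (p ! g k) (p ! g (Suc k))"
        using path_nth_adjacent[OF p(1)] gl[OF k] by simp
      then show ?thesis using \<phi>_adjacent sep[of k "Suc k"] k by (simp add: qn)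
    next
      case True
      then have gk: "g k = k" "g (Suc k) = j" by (auto simp: g_def)
      have ab: "a \<in> verts S" "b \<in> verts S" "\<not> od \<Longrightarrow> c \<in> verts S" by (auto simp: verts_S)
      have qb: "q ! Suc k = b" using qn[OF k] gk ij \<phi>_2 by simp
      show ?thesis
      proof (cases od)
        case od: True
        then have "k = i" using True by (simp add: t_def)
        then have "q ! k = a" using qn[of k] k gk ij \<phi>_2 by simp
        then show ?thesis using qb ab theta_a_b od markers_distinct by (simp add: adjacent_def)
      next
        case od: False
        then have ki: "k = Suc i" using True by (simp add: t_def)
        then have "p ! k \<in> C2" using run tj(1) True by simp
        then have "q ! k = c" using qn[of k] k gk \<phi>_2 by simp
        then show ?thesis
          using qb ab theta_b_c theta_S_sym[of b c] od markers_distinct by (simp add: adjacent_def)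
      qed
    qed
  next
    fix k l assume kl: "Suc k < l" "l < length q"
    then have "antiadjacent T (p ! g k) (p ! g l)"
      using path_nth_antiadjacent[OF p(1)] gl[of l] gadj(2)[of k l] by (simp add: lq)
    then show "antiadjacent S (q ! k) (q ! l)"
      using \<phi>_antiadjacent sep[of k l] kl by (simp add: qn lq)
  qed
  moreover have "n = length p - (j - t)" using tj ij by (auto simp: n_def)
  then have "even n" using p(2) tj(2) ij(2) by simp
  \<comment> \<open>\<open>p ! 0\<close> lies in \<open>X1\<close> and so differs from
    \<open>p ! i\<close>; with \<open>p ! j\<close> this makes three vertices, and parity supplies
    the fourth.\<close>
  moreover have "3 \<le> n" using tj i0 ij(2) by (simp add: n_def)
  then have "4 \<le> n" using \<open>even n\<close> by (cases "n = 3") auto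
  moreover have "hd q = \<phi> (hd p)" "last q = \<phi> (last p)"
  proof -
    have ne: "q \<noteq> []" "p \<noteq> []" using lq \<open>4 \<le> n\<close> p(1) by (auto simp: is_path_def)
    have "g 0 = 0" "g (n - 1) = length p - 1" using tj i0 ij(2) by (auto simp: g_def n_def)
    then show "hd q = \<phi> (hd p)" "last q = \<phi> (last p)"
      using ne qn[of 0] qn[of "n - 1"] lq \<open>4 \<le> n\<close> by (simp_all add: hd_conv_nth last_conv_nth)
  qed
  moreover have "path_interior q \<subseteq> \<phi> ` path_interior p"
  proof
    fix x assume "x \<in> path_interior q"
    then obtain k where k: "0 < k" "k < n - 1" "x = q ! k" using path_interior_conv lq by metis
    then have "0 < g k" "g k < length p - 1" using tj ij(2) by (auto simp: g_def n_def)
    then show "x \<in> \<phi> ` path_interior p" using path_interior_nth[of "g k" p] qn[of k] k by simp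
  qed
  ultimately show ?thesis unfolding odd_path_image_def lq[symmetric] by blast
qed

text \<open>Without vertices in \<open>C2\<close>, \<open>\<phi>\<close> is injective on the path.
  Otherwise every run in \<open>C2\<close> is bounded by the only vertex of \<open>A2\<close> and
  the only vertex of \<open>B2\<close>, so there is just one run, and it can be contracted.\<close>

lemma path_transfer:
  assumes p: "is_path T p" "even (length p)" "4 \<le> length p" "p ! 0 \<in> X1" "p ! (length p - 1) \<notin> C2"
    and uniq: "\<And>k l. k < length p \<Longrightarrow> l < length p \<Longrightarrow> p ! k \<in> A2 \<Longrightarrow> p ! l \<in> A2 \<Longrightarrow> k = l"
      "\<And>k l. k < length p \<Longrightarrow> l < length p \<Longrightarrow> p ! k \<in> B2 \<Longrightarrow> p ! l \<in> B2 \<Longrightarrow> k = l"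
  shows "\<exists>q. odd_path_image S \<phi> p q"
proof (cases "\<exists>l<length p. p ! l \<in> C2")
  case False
  then have sep: "separated (set p)" by (intro separatedI_nth uniq) auto
  have "is_path S (map \<phi> p)"
    by (rule is_path_map[OF p(1)]) (use p(3) separated_adjacent[OF sep] in auto)
  then show ?thesis using odd_path_image_map p(2,3) by blast
next
  case True
  have 0: "p ! 0 \<notin> C2" using p(4) X_facts by blast
  obtain l where l: "l < length p" "p ! l \<in> C2" using True by blast
  obtain i j where ij: "i < l" "l < j" "j < length p" "\<forall>k. i < k \<and> k < j \<longrightarrow> p ! k \<in> C2"
    "p ! i \<in> A2 \<union> B2" "p ! j \<in> A2 \<union> B2" using C2_run[OF p(1) 0 p(5) l] .
  have il: "i < length p" using ij by linarith
  have pij: "p ! i \<in> A2 \<and> p ! j \<in> B2 \<or> p ! i \<in> B2 \<and> p ! j \<in> A2"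
    using ij uniq[OF il ij(3)] by auto
  have C2: "i < k \<and> k < j" if k: "k < length p" "p ! k \<in> C2" for k
  proof -
    obtain i' j' where ij': "i' < k" "k < j'" "j' < length p"
      "p ! i' \<in> A2 \<union> B2" "p ! j' \<in> A2 \<union> B2" using C2_run[OF p(1) 0 p(5) k] by metis
    have il': "i' < length p" using ij' by linarith
    have "i' = i \<or> i' = j" "j' = i \<or> j' = j"
      using pij ij'(4,5) uniq il il' ij(3) ij'(3) by auto
    then show ?thesis using ij'(1,2) ij(1,2) by auto
  qed
  from pij show ?thesis
  proof
    assume "p ! i \<in> A2 \<and> p ! j \<in> B2"
    then show ?thesis
      using contract_side_path[OF p(1,2,4) uniq _ ij(3) _ _ ij(4) C2] ij(1,2) by auto
  next
    assume "p ! i \<in> B2 \<and> p ! j \<in> A2"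
    then show ?thesis
      using two_join_block.contract_side_path[OF swap, unfolded X1_swap,
          OF p(1,2,4) uniq(2,1) _ ij(3) _ _ ij(4) C2] ij(1,2) by auto
  qed
qed

text \<open>\<open>B2\<close> is confined to the last vertex. If \<open>A2\<close> is met, the entry
  into \<open>X2\<close> comes before the end, hence is through \<open>A2\<close>, and
  \<open>path_A2_after_entry\<close> applies.\<close>

lemma path_transfer_X1_B2:
  assumes p: "is_path T p" "even (length p)" "4 \<le> length p"
    and ends: "p ! 0 \<in> X1" "p ! (length p - 1) \<in> B2"
    and int: "\<And>i. 0 < i \<Longrightarrow> i < length p - 1 \<Longrightarrow> p ! i \<notin> B2"
  shows "\<exists>q. odd_path_image S \<phi> p q"
proof (rule path_transfer[OF p ends(1)])
  show "p ! (length p - 1) \<notin> C2" using ends(2) X_facts by blast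
next
  have "k = length p - 1" if "k < length p" "p ! k \<in> B2" for k
  proof (rule ccontr)
    assume "k \<noteq> length p - 1"
    then have "k < length p - 1" "k = 0 \<or> 0 < k" using that(1) by auto
    then show False using int[of k] that(2) ends(1) X_facts(4,6) by auto
  qed
  then show "k = l" if "k < length p" "l < length p" "p ! k \<in> B2" "p ! l \<in> B2" for k l
    using that by metis
next
  fix k l assume kl: "k < length p" "l < length p" "p ! k \<in> A2" "p ! l \<in> A2"
  obtain m where m: "Suc m \<le> k" "p ! m \<in> X1" "p ! Suc m \<in> X2" "joined (p ! m) (p ! Suc m)"
    "\<forall>k\<le>m. p ! k \<in> X1"
    using path_enters_X2[OF p(1) ends(1) kl(1)] kl(3) X_facts(3) by metis
  have "k \<noteq> length p - 1" using kl(3) ends(2) X_facts(8) by metis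
  then have "p ! Suc m \<notin> B2" using int[of "Suc m"] m(1) kl(1) by simp
  then have "p ! Suc m \<in> A2" using joined_X2[OF m(4)] by blast
  then show "k = l" using path_A2_after_entry[OF p(1) m(2,4) _ m(5)] kl by metis
qed

text \<open>Inside \<open>X2\<close>, a vertex of \<open>B1\<close> closes the path to an odd hole.
  A path that visits \<open>X1\<close> cannot do so next to an end, as the visiting vertex would see
  both ends; so it leaves and returns through \<open>A2\<close>, and the visit is a single vertex.
  The two remaining pieces are side paths of equal parity, which makes the number of vertices
  odd.\<close>

lemma no_odd_path_B2_B2:
  assumes p: "is_path T p" "even (length p)" "4 \<le> length p"
    and ends: "p ! 0 \<in> B2" "p ! (length p - 1) \<in> B2"
    and int: "\<And>i. 0 < i \<Longrightarrow> i < length p - 1 \<Longrightarrow> p ! i \<notin> B2"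
  shows False
proof (cases "\<exists>l<length p. p ! l \<in> X1")
  case False
  then have X2: "p ! k \<in> X2" if "k < length p" for k
    using path_nth_verts[OF p(1) that] that verts_T_iff by blast
  obtain v where v: "v \<in> B1" using nonempty1 by blast
  have "is_hole T (v # p)"
  proof (rule hole_Cons[OF p(1)])
    show "3 \<le> length p" using p(3) by simp
    show "adjacent T v (p ! 0)" "adjacent T v (p ! (length p - 1))"
      using cross(1) v ends X_facts by (auto simp: joined_def)
    show "antiadjacent T v (p ! i)" if "0 < i" "i < length p - 1" for i
      using cross(2)[OF _ X2, of v i] int[OF that] v that X_facts by (auto simp: joined_def)
  qed
  then show False using berge_T p(2) unfolding berge_def by (metis length_Cons even_Suc)
next
  case True
  let ?n = "length p"
  let ?P = "\<lambda>i. i < ?n \<and> p ! i \<in> X1"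
  obtain l where l: "?P l" using True by blast
  define i where "i = (LEAST i. ?P i)"
  define j where "j = (GREATEST i. ?P i)"
  have i: "?P i" unfolding i_def by (rule LeastI[of ?P, OF l])
  have imin: "i \<le> k" if "?P k" for k unfolding i_def using that by (rule Least_le)
  have j: "?P j" unfolding j_def by (rule GreatestI_nat[of ?P l ?n]) (use l in auto)
  have jmax: "k \<le> j" if "?P k" for k
    unfolding j_def by (rule Greatest_le_nat[of ?P k ?n]) (use that in auto)
  have X2: "p ! k \<in> X2" if "k < ?n" "k < i \<or> j < k" for k
    using path_nth_verts[OF p(1) that(1)] imin[of k] jmax[of k] that verts_T_iff by auto
  have X20: "p ! 0 \<in> X2" "p ! (?n - 1) \<in> X2" using ends X_facts by auto
  have ij: "i \<le> j" using imin j by blast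
  have "i \<noteq> 0" "j \<noteq> ?n - 1" using i j X20 X_facts(6) by metis+
  then have ij0: "0 < i" "j < ?n - 1" using j by auto
  have n0: "0 < ?n" "?n - 1 < ?n" using p(3) by auto
  have far: "\<not> (joined (p ! k) (p ! 0) \<and> joined (p ! k) (p ! (?n - 1)))" if "?P k" for k
    using path_cross[OF p(1), of k 0] path_cross[OF p(1), of k "?n - 1"] that X20 n0 p(3) by auto
  have ji: "joined (p ! i) (p ! (i - 1))"
    using path_cross[OF p(1), of i "i - 1"] i ij0 X2[of "i - 1"] by auto
  have jj: "joined (p ! j) (p ! Suc j)"
    using path_cross[OF p(1), of j "Suc j"] j ij0 X2[of "Suc j"] by auto
  have i1: "i \<noteq> 1"
  proof
    assume "i = 1"
    then have "joined (p ! i) (p ! 0)" using ji by simp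
    then show False using far[OF i] joined_B2 ends by blast
  qed
  have j1: "Suc j \<noteq> ?n - 1"
  proof
    assume "Suc j = ?n - 1"
    then have "joined (p ! j) (p ! (?n - 1))" using jj by simp
    then show False using far[OF j] joined_B2 ends by blast
  qed
  have Ai: "p ! (i - 1) \<in> A2" using joined_X2[OF ji] int[of "i - 1"] i1 ij0 ij by auto
  have Aj: "p ! Suc j \<in> A2" using joined_X2[OF jj] int[of "Suc j"] j1 ij0 by auto
  have "joined (p ! i) (p ! Suc j)" using joined_A2[OF ji Ai Aj] .
  then have eq: "j = i"
    using path_cross[OF p(1), of i "Suc j"] i ij0 ij X2[of "Suc j"] by auto
  have C2: "p ! k \<in> C2" if "0 < k" "k < ?n - 1" "k \<noteq> i" "Suc k \<noteq> i" "k \<noteq> Suc i" for k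
  proof -
    have kn: "k < ?n" "k < i \<or> j < k" using that eq by linarith+
    then have k: "p ! k \<in> X2" "p ! k \<notin> B2" using X2[of k] int[of k] that by blast+
    moreover have "p ! k \<notin> A2"
      using path_cross[OF p(1), of i k] joined_A2[OF ji Ai] i k kn that by auto
    ultimately show ?thesis by (simp add: X2_iff)
  qed
  \<comment> \<open>The first piece runs from \<open>B2\<close> to \<open>A2\<close>, whence the
    exchanged instance.\<close>
  have "odd (i - 1 - 0) \<longleftrightarrow> od"
    by (rule two_join_block.segment_parity[OF swap p(1)]) (use C2 i i1 ij0 ends Ai ij eq in auto)
  moreover have "odd (?n - 1 - Suc i) \<longleftrightarrow> od"
    by (rule segment_parity[OF p(1)]) (use C2 i j1 ij0 ends Aj ij eq in auto)
  moreover have "(i - 1 - 0) + (?n - 1 - Suc i) = ?n - 3" using i1 j1 ij0 ij eq by auto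
  ultimately have "even (?n - 3)" by (metis even_add)
  then show False using p(2,3) by auto
qed

text \<open>As \<open>a\<close> and \<open>c\<close> avoid \<open>B'\<close>, the ends lie in
  \<open>X1\<close> or \<open>B2\<close>. An end in \<open>B2\<close> means
  \<open>b \<in> B'\<close>, and this keeps the interior out of \<open>B2\<close>.\<close>

lemma no_odd_path:
  assumes noS: "\<And>q. is_path S q \<Longrightarrow> even (length q) \<Longrightarrow> 4 \<le> length q \<Longrightarrow> hd q \<in> B' \<Longrightarrow>
      last q \<in> B' \<Longrightarrow> path_interior q \<inter> B' = {} \<Longrightarrow> False"
    and ac: "a \<notin> B'" "c \<notin> B'"
    and p: "is_path T p" "even (length p)" "4 \<le> length p"
    and ends: "\<phi> (p ! 0) \<in> B'" "\<phi> (p ! (length p - 1)) \<in> B'"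
    and int: "\<And>i. 0 < i \<Longrightarrow> i < length p - 1 \<Longrightarrow> \<phi> (p ! i) \<notin> B'"
  shows False
proof -
  let ?n = "length p"
  have ne: "p \<noteq> []" and n0: "0 < ?n" "?n - 1 < ?n" using p(3) by auto
  have "\<phi> x \<notin> B'" if "x \<in> path_interior p" for x
    using int path_interior_conv[OF that] by auto
  then have "\<phi> ` path_interior p \<inter> B' = {}" by blast
  then have disj: "path_interior q \<inter> B' = {}" if "path_interior q \<subseteq> \<phi> ` path_interior p" for q
    using that by blast
  have no_image: "\<not> odd_path_image S \<phi> p q" "\<not> odd_path_image S \<phi> (rev p) q" for q
    using noS[of q] disj[of q] ends ne
    by (auto simp: odd_path_image_def hd_conv_nth last_conv_nth path_interior_rev hd_rev last_rev)
  have XB: "p ! k \<in> X1 \<or> p ! k \<in> B2" if "k < ?n" "\<phi> (p ! k) \<in> B'" for k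
    using path_nth_verts[OF p(1) that(1)] that(2) ac \<phi>_2 by (auto simp: verts_T_iff X2_iff)
  have intB: "p ! i \<notin> B2" if "b \<in> B'" "0 < i" "i < ?n - 1" for i
    using int that \<phi>_2(2) by metis
  have b: "b \<in> B'" if "p ! 0 \<in> B2 \<or> p ! (?n - 1) \<in> B2" using that \<phi>_2(2) ends by metis
  consider "p ! 0 \<in> X1" "p ! (?n - 1) \<in> X1" | "p ! 0 \<in> X1" "p ! (?n - 1) \<in> B2"
    | "p ! 0 \<in> B2" "p ! (?n - 1) \<in> X1" | "p ! 0 \<in> B2" "p ! (?n - 1) \<in> B2"
    using XB ends n0 by blast
  then show False
  proof cases
    case 1
    have "p ! (?n - 1) \<notin> C2" using 1 X_facts by blast
    then have "\<exists>q. odd_path_image S \<phi> p q"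
      using path_transfer[OF p 1(1)] path_unique_A2[OF p(1) 1] path_unique_B2[OF p(1) 1] by blast
    then show False using no_image by blast
  next
    case 2
    then show False using path_transfer_X1_B2[OF p 2] intB b no_image by blast
  next
    case 3
    have r: "rev p ! 0 \<in> X1" "rev p ! (length (rev p) - 1) \<in> B2"
      using 3 n0 by (auto simp: rev_nth)
    have "rev p ! i \<notin> B2" if "0 < i" "i < length (rev p) - 1" for i
      using intB[of "?n - Suc i"] b 3 that by (auto simp: rev_nth)
    then show False
      using path_transfer_X1_B2[OF is_path_rev[OF wf_T p(1)] _ _ r] p(2,3) no_image by auto
  next
    case 4
    then show False using no_odd_path_B2_B2[OF p 4] intB b by blast
  qed
qed

section \<open>Odd antipaths\<close>

lemma antipath_nth_verts: "is_antipath T p \<Longrightarrow> i < length p \<Longrightarrow> p ! i \<in> verts T"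
  using path_nth_verts[of "tri_complement T"] by (simp add: is_antipath_def)

text \<open>Serves the case \<open>b \<notin> B'\<close>. Only the ends can lie in
  \<open>X2\<close>. Each is adjacent to an interior vertex, which excludes \<open>C2\<close>; and
  the second vertex sees the last but not the first, whereas two vertices of \<open>A2\<close>, or
  of \<open>B2\<close>, have the same neighbours in \<open>X1\<close>.\<close>

lemma antipath_separated_X1:
  assumes p: "is_antipath T p" "4 \<le> length p"
    and int: "\<And>i. 0 < i \<Longrightarrow> i < length p - 1 \<Longrightarrow> p ! i \<in> X1"
  shows "separated (set p)"
proof -
  let ?n = "length p"
  have ends: "k = 0 \<or> k = ?n - 1" if "k < ?n" "p ! k \<in> X2" for k
    using int[of k] that X_facts(6) by (cases "k = 0 \<or> k = ?n - 1") auto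
  have ne: "p \<noteq> []" using p(2) by auto
  have int1: "p ! 1 \<in> X1" "p ! 2 \<in> X1" "p ! (?n - 3) \<in> X1" using int p(2) by auto
  have C2: "p ! k \<notin> C2" if "k < ?n" for k
  proof
    assume k: "p ! k \<in> C2"
    then have X2: "p ! k \<in> X2" using X_facts by blast
    have "joined (p ! 2) (p ! 0)" if "k = 0"
      using antipath_cross[OF p(1), of 2 0] int1 X2 that p(2) ne by auto
    moreover have "joined (p ! (?n - 3)) (p ! (?n - 1))" if "k = ?n - 1"
      using antipath_cross[OF p(1), of "?n - 3" "?n - 1"] int1 X2 that p(2) ne by auto
    ultimately have "p ! k \<in> A2 \<or> p ! k \<in> B2" using ends[OF that X2] joined_X2 by metis
    then show False using k X_facts by blast
  qed
  have neq: "\<not> (p ! 0 \<in> D \<and> p ! (?n - 1) \<in> D)" if D: "D = A2 \<or> D = B2" for D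
  proof
    assume 0: "p ! 0 \<in> D \<and> p ! (?n - 1) \<in> D"
    then have X2: "p ! 0 \<in> X2" "p ! (?n - 1) \<in> X2" using D X_facts by auto
    have "joined (p ! 1) (p ! (?n - 1))" "\<not> joined (p ! 1) (p ! 0)"
      using antipath_cross[OF p(1), of 1 "?n - 1"] antipath_cross[OF p(1), of 1 0] X2 int1 p(2) ne
      by auto
    then show False using 0 D joined_A2 joined_B2 by blast
  qed
  have uniq: "k = l" if "D = A2 \<or> D = B2" "k < ?n" "l < ?n" "p ! k \<in> D" "p ! l \<in> D" for D k l
  proof -
    have "p ! k \<in> X2" "p ! l \<in> X2" using that X_facts by auto
    then show ?thesis using ends[OF that(2)] ends[OF that(3)] neq[OF that(1)] that by metis
  qed
  show ?thesis by (rule separatedI_nth) (use uniq C2 in blast)+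
qed

text \<open>If everything lies in \<open>X2\<close>, a vertex of \<open>B1\<close> completes the
  antipath to an odd antihole. Otherwise some vertex of \<open>X1\<close> is next to one of
  \<open>B2\<close> on the antipath; it then sees nothing of \<open>B2\<close>, so all vertices of
  \<open>B2\<close> are next to it. Two of them, one on each side, force five vertices in all,
  against parity.\<close>

lemma antipath_unique_B2:
  assumes p: "is_antipath T p" "even (length p)" "4 \<le> length p"
    and ends: "p ! 0 \<notin> B2" "p ! (length p - 1) \<notin> B2"
    and int: "\<And>i. 0 < i \<Longrightarrow> i < length p - 1 \<Longrightarrow> p ! i \<in> X1 \<or> p ! i \<in> B2"
    and kl: "k < length p" "l < length p" "p ! k \<in> B2" "p ! l \<in> B2"
  shows "k = l"
proof (rule ccontr)
  let ?n = "length p"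
  assume "k \<noteq> l"
  have in_int: "0 < i \<and> i < ?n - 1" if "i < ?n" "p ! i \<in> B2" for i
    using that ends by (cases "i = 0"; cases "i = ?n - 1") auto
  show False
  proof (cases "\<exists>x<?n. p ! x \<in> X1")
    case False
    then have X2: "p ! i \<in> X2" if "i < ?n" for i
      using antipath_nth_verts[OF p(1) that] that verts_T_iff by blast
    obtain v where v: "v \<in> B1" using nonempty1 by blast
    have vX: "v \<in> X1" "v \<notin> A1" using v X_facts by auto
    have n0: "0 < ?n" "?n - 1 < ?n" using p(3) by auto
    have "is_hole (tri_complement T) (v # p)"
    proof (rule hole_Cons)
      show "is_path (tri_complement T) p" using p(1) by (simp add: is_antipath_def)
      show "3 \<le> ?n" using p(3) by simp
      show "adjacent (tri_complement T) v (p ! 0)" "adjacent (tri_complement T) v (p ! (?n - 1))"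
        using cross(2)[OF vX(1) X2[OF n0(1)]] cross(2)[OF vX(1) X2[OF n0(2)]] ends vX
        by (auto simp: joined_def)
      show "antiadjacent (tri_complement T) v (p ! i)" if "0 < i" "i < ?n - 1" for i
        using cross(1)[OF vX(1) X2, of i] int[OF that] that v X2[of i] X_facts(6)[of "p ! i"]
        by (auto simp: joined_def)
    qed
    then show False using berge_T p(2) unfolding berge_def is_antihole_def
      by (metis length_Cons even_Suc)
  next
    case True
    then obtain x where x: "x < ?n" "p ! x \<in> X1" by blast
    have "p ! k \<notin> X1" using kl X_facts by blast
    then obtain m m' where mm: "m' = Suc m \<or> m = Suc m'" "p ! m \<in> X1" "p ! m' \<notin> X1"
      "min x k \<le> m" "m \<le> max x k" "min x k \<le> m'" "m' \<le> max x k"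
      using exists_switch[of "\<lambda>i. p ! i \<in> X1" x k] x by metis
    have ml: "m < ?n" "m' < ?n" using mm x kl by auto
    have "m' \<noteq> x" using mm(3) x by metis
    \<comment> \<open>\<open>m'\<close> lies between \<open>x\<close> and \<open>k\<close> and is
      not \<open>x\<close>, so it is \<open>k\<close> or an interior position; either way it is in
      \<open>B2\<close>.\<close>
    then have "m' = k \<or> (0 < m' \<and> m' < ?n - 1)" using mm x kl by (auto simp: min_def max_def split: if_splits)
    then have m'B: "p ! m' \<in> B2" using int[of m'] mm(3) kl by blast
    have "\<not> joined (p ! m) (p ! m')"
      using antipath_cross[OF p(1) ml mm(2)] m'B X_facts mm(1) by blast
    then have near: "i = Suc m \<or> m = Suc i" if "i < ?n" "p ! i \<in> B2" for i
      using antipath_cross[OF p(1) ml(1) that(1) mm(2)] joined_B2 m'B that(2) X_facts by blast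
    obtain r where r: "m = Suc r" "p ! r \<in> B2" "p ! Suc m \<in> B2" "r < ?n" "Suc m < ?n"
      using near[OF kl(1,3)] near[OF kl(2,4)] \<open>k \<noteq> l\<close> kl by auto
    note rint = in_int[OF r(4,2)] in_int[OF r(5,3)]
    have X2: "p ! r \<in> X2" "p ! Suc m \<in> X2" using r X_facts by auto
    have lt: "Suc (Suc m) < ?n" "r - 1 < ?n" using rint by linarith+
    \<comment> \<open>A vertex of \<open>X1\<close> here would see \<open>p ! r\<close> but not
      \<open>p ! Suc m\<close>, two vertices of \<open>B2\<close>.\<close>
    have "p ! Suc (Suc m) \<notin> X1"
      using antipath_cross[OF p(1), of "Suc (Suc m)" "Suc m"] antipath_cross[OF p(1), of "Suc (Suc m)" r]
        joined_B2 r rint X2 lt by auto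
    moreover have "p ! Suc (Suc m) \<notin> B2" using near[of "Suc (Suc m)"] lt by auto
    ultimately have "Suc (Suc m) = ?n - 1" using int[of "Suc (Suc m)"] rint by linarith
    moreover have "p ! (r - 1) \<notin> X1"
      using antipath_cross[OF p(1), of "r - 1" r] antipath_cross[OF p(1), of "r - 1" "Suc m"]
        joined_B2 r rint X2 lt by auto
    then have "r - 1 = 0" using int[of "r - 1"] near[of "r - 1"] rint lt r(1) by force
    \<comment> \<open>Both outer neighbours are ends, so \<open>r = 1\<close>, \<open>m = 2\<close>,
      and the last position is 4.\<close>
    ultimately have "?n = 5" using r(1) rint by auto
    then show False using p(2) by simp
  qed
qed

text \<open>The end in \<open>C2\<close> sees nothing of \<open>X1\<close>, so from the third vertex
  on the antipath avoids \<open>X1\<close>; with at most one vertex in \<open>B2\<close> this leaves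
  four vertices. Then \<open>p ! 3\<close>, \<open>p ! 0\<close>, \<open>p ! 2\<close> form a side
  path of length two, so the join is even and \<open>c\<close> is available as the image of
  \<open>p ! 0\<close>.\<close>

lemma antipath_separated_C2:
  assumes p: "is_antipath T p" "even (length p)" "4 \<le> length p"
    and ends: "p ! 0 \<in> C2" "p ! (length p - 1) \<notin> B2"
    and int: "\<And>i. 0 < i \<Longrightarrow> i < length p - 1 \<Longrightarrow> p ! i \<in> X1 \<or> p ! i \<in> B2"
  shows "separated (set p)"
proof -
  let ?n = "length p"
  have "p ! 0 \<notin> B2" using ends X_facts by blast
  note uB = antipath_unique_B2[OF p this ends(2) int]
  have 0: "p ! 0 \<in> X2" "\<not> joined u (p ! 0)" for u using ends X_facts joined_X2 by blast+
  have ne: "p \<noteq> []" using p(3) by auto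
  have no: "p ! i \<notin> X1" if "1 < i" "i < ?n" for i
    using antipath_cross[OF p(1) that(2), of 0] 0 that ne by auto
  have 2: "p ! 2 \<in> B2" using no[of 2] int[of 2] p(3) by auto
  have lt: "1 < ?n - 1" "1 < ?n" "2 < ?n" "3 < ?n" using p(3) by linarith+
  have 1: "p ! 1 \<in> X1" using int[of 1] uB[of 1 2] 2 lt by auto
  have n4: "?n = 4"
  proof (rule ccontr)
    assume "?n \<noteq> 4"
    then have "4 < ?n" using p(3) by simp
    then have "p ! 3 \<in> B2" using no[of 3] int[of 3] by auto
    then show False using uB[of 2 3] 2 lt by auto
  qed
  have "p ! 3 \<notin> X1" using no[of 3] n4 by simp
  then have 3: "p ! 3 \<in> X2" using antipath_nth_verts[OF p(1), of 3] n4 verts_T_iff by auto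
  have "joined (p ! 1) (p ! 3)" using antipath_cross[OF p(1), of 1 3] 1 3 n4 by auto
  then have A: "p ! 3 \<in> A2" using joined_X2 ends(2) n4 by auto
  have p': "is_path (tri_complement T) p" using p(1) by (simp add: is_antipath_def)
  have adj: "adjacent T (p ! 3) (p ! 0)" "adjacent T (p ! 0) (p ! 2)" "antiadjacent T (p ! 3) (p ! 2)"
    using path_nth_antiadjacent[OF p', of 0 3] path_nth_antiadjacent[OF p', of 0 2]
      path_nth_adjacent[OF p', of 2] n4 adjacent_sym[OF wf_T] antiadjacent_sym[OF wf_T]
    by (auto simp: numeral_3_eq_3 numeral_2_eq_2)
  have "is_path T [p ! 3, p ! 0, p ! 2]"
    using adj by (intro is_pathI) (auto simp: nth_Cons less_Suc_eq numeral_2_eq_2 split: nat.splits)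
  then have "side_path T A2 B2 C2 [p ! 3, p ! 0, p ! 2]"
    using A 2 ends by (simp add: side_path_def path_interior_def)
  then have od: "\<not> od" using parity[of "[p ! 3, p ! 0, p ! 2]"] by (simp add: path_length_def)
  have cases4: "i = 0 \<or> i = 1 \<or> i = 2 \<or> i = 3" if "i < ?n" for i using that n4 by auto
  have onlyA: "i = 3" if "i < ?n" "p ! i \<in> A2" for i
    using cases4[OF that(1)] that(2) ends 1 2 X_facts by metis
  have onlyC: "i = 0" if "i < ?n" "p ! i \<in> C2" for i
    using cases4[OF that(1)] that(2) A 1 2 X_facts by metis
  show ?thesis by (rule separatedI_nth) (use onlyA onlyC uB od in blast)+
qed

text \<open>Serves the case \<open>b \<in> B'\<close>. Two ends in \<open>A2\<close> have the same
  neighbours in \<open>X1\<close>, while a second or last but one vertex in \<open>X1\<close> would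
  see exactly one of them; so both these vertices would lie in \<open>B2\<close>, against
  uniqueness.\<close>

lemma antipath_separated_B2:
  assumes p: "is_antipath T p" "even (length p)" "4 \<le> length p"
    and ends: "p ! 0 \<notin> B2" "p ! (length p - 1) \<notin> B2"
    and int: "\<And>i. 0 < i \<Longrightarrow> i < length p - 1 \<Longrightarrow> p ! i \<in> X1 \<or> p ! i \<in> B2"
  shows "separated (set p)"
proof -
  let ?n = "length p"
  note uB = antipath_unique_B2[OF p ends int]
  have ne: "p \<noteq> []" using p(3) by auto
  consider "p ! 0 \<in> C2" | "p ! (?n - 1) \<in> C2" | "p ! 0 \<notin> C2" "p ! (?n - 1) \<notin> C2" by blast
  then show ?thesis
  proof cases
    case 1
    then show ?thesis using antipath_separated_C2[OF p 1 ends(2) int] by blast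
  next
    case 2
    have "is_antipath T (rev p)"
      using p(1) is_path_rev[OF wf_trigraph_tri_complement[OF wf_T]] by (simp add: is_antipath_def)
    moreover have "rev p ! 0 \<in> C2" "rev p ! (length (rev p) - 1) \<notin> B2"
      using 2 ends ne by (auto simp: rev_nth)
    moreover have "rev p ! i \<in> X1 \<or> rev p ! i \<in> B2" if "0 < i" "i < length (rev p) - 1" for i
      using int[of "?n - Suc i"] that by (auto simp: rev_nth)
    ultimately have "separated (set (rev p))" using antipath_separated_C2[of "rev p"] p(2,3) by auto
    then show ?thesis by simp
  next
    case 3
    have cases: "k = 0 \<or> k = ?n - 1 \<or> p ! k \<in> X1 \<or> p ! k \<in> B2" if "k < ?n" for k
      using int[of k] that by linarith
    have C2: "p ! k \<notin> C2" if "k < ?n" for k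
      using cases[OF that] 3 X_facts by metis
    have endA: "k = 0 \<or> k = ?n - 1" if "k < ?n" "p ! k \<in> A2" for k
      using cases[OF that(1)] that(2) X_facts by metis
    have "\<not> (p ! 0 \<in> A2 \<and> p ! (?n - 1) \<in> A2)"
    proof
      assume A: "p ! 0 \<in> A2 \<and> p ! (?n - 1) \<in> A2"
      then have X2: "p ! 0 \<in> X2" "p ! (?n - 1) \<in> X2" using X_facts by auto
      have eq: "joined u (p ! 0) \<longleftrightarrow> joined u (p ! (?n - 1))" for u
        using A joined_A2 by blast
      have "p ! 1 \<notin> X1"
        using antipath_cross[OF p(1), of 1 0] antipath_cross[OF p(1), of 1 "?n - 1"]
          eq X2 p(3) ne by auto
      moreover have "p ! (?n - 2) \<notin> X1"
        using antipath_cross[OF p(1), of "?n - 2" 0] antipath_cross[OF p(1), of "?n - 2" "?n - 1"]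
          eq X2 p(3) ne by auto
      moreover have lt: "1 < ?n - 1" "1 < ?n" "?n - 2 < ?n" "1 \<noteq> ?n - 2" using p(3) by linarith+
      ultimately have "p ! 1 \<in> B2" "p ! (?n - 2) \<in> B2" using int[of 1] int[of "?n - 2"] p(3) by auto
      then show False using uB[of 1 "?n - 2"] lt by auto
    qed
    then have uA: "k = l" if "k < ?n" "l < ?n" "p ! k \<in> A2" "p ! l \<in> A2" for k l
      using endA[OF that(1,3)] endA[OF that(2,4)] that by metis
    show ?thesis by (rule separatedI_nth) (use uA uB C2 in blast)+
  qed
qed

lemma no_odd_antipath:
  assumes noS: "\<And>q. is_antipath S q \<Longrightarrow> even (length q) \<Longrightarrow> 4 \<le> length q \<Longrightarrow> hd q \<notin> B' \<Longrightarrow>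
      last q \<notin> B' \<Longrightarrow> path_interior q \<subseteq> B' \<Longrightarrow> False"
    and ac: "a \<notin> B'" "c \<notin> B'"
    and p: "is_antipath T p" "even (length p)" "4 \<le> length p"
    and ends: "\<phi> (p ! 0) \<notin> B'" "\<phi> (p ! (length p - 1)) \<notin> B'"
    and int: "\<And>i. 0 < i \<Longrightarrow> i < length p - 1 \<Longrightarrow> \<phi> (p ! i) \<in> B'"
  shows False
proof -
  let ?n = "length p"
  have p': "is_path (tri_complement T) p" using p(1) by (simp add: is_antipath_def)
  have ne: "p \<noteq> []" using p(3) by auto
  have XB: "p ! i \<in> X1 \<or> p ! i \<in> B2" if "0 < i" "i < ?n - 1" for i
  proof -
    have "p ! i \<in> verts T" using antipath_nth_verts[OF p(1)] that by simp
    then show ?thesis using int[OF that] ac \<phi>_2 by (auto simp: verts_T_iff X2_iff)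
  qed
  have sep: "separated (set p)"
  proof (cases "b \<in> B'")
    case True
    then have "p ! 0 \<notin> B2" "p ! (?n - 1) \<notin> B2" using ends \<phi>_2 by metis+
    then show ?thesis using antipath_separated_B2[OF p] XB by blast
  next
    case False
    have "p ! i \<in> X1" if "0 < i" "i < ?n - 1" for i using XB[OF that] int[OF that] False \<phi>_2 by metis
    then show ?thesis using antipath_separated_X1[OF p(1,3)] by blast
  qed
  have "is_path (tri_complement S) (map \<phi> p)"
    by (rule is_path_map[OF p']) (use p(3) separated_adjacent[OF sep] in auto)
  then have img: "odd_path_image (tri_complement S) \<phi> p (map \<phi> p)"
    using odd_path_image_map p(2,3) by blast
  have "\<phi> x \<in> B'" if "x \<in> path_interior p" for x
    using int path_interior_conv[OF that] by auto
  then have "path_interior (map \<phi> p) \<subseteq> B'" using img unfolding odd_path_image_def by blast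
  then show False
    using noS[of "map \<phi> p"] img ends ne
    by (simp add: odd_path_image_def is_antipath_def hd_conv_nth last_conv_nth hd_map last_map)
qed

section \<open>Markers and the pullback of the skew-partition\<close>

lemma markers_in_S: "a \<in> verts S" "b \<in> verts S" "\<not> od \<Longrightarrow> c \<in> verts S"
  by (auto simp: verts_S)

lemma verts_S_cases:
  assumes "x \<in> verts S"
  obtains u where "u \<in> X1" "x = \<phi> u" | "x = a" | "x = b" | "x = c" "\<not> od"
  using assms by (auto simp: verts_S X1_def split: if_splits)

lemma theta_marker:
  "u \<in> X1 \<Longrightarrow> theta S a (\<phi> u) = (if u \<in> A1 then 1 else -1)"
  "u \<in> X1 \<Longrightarrow> theta S b (\<phi> u) = (if u \<in> B1 then 1 else -1)"
  "\<not> od \<Longrightarrow> u \<in> X1 \<Longrightarrow> theta S c (\<phi> u) = -1"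
  "theta S b a = (if od then 0 else -1)" "\<not> od \<Longrightarrow> theta S c a = 0" "\<not> od \<Longrightarrow> theta S c b = 0"
proof -
  have u: "\<phi> u \<in> verts S" "\<phi> u \<noteq> a" "\<phi> u \<noteq> b" "\<phi> u \<noteq> c" if "u \<in> X1"
    using that \<phi>_X1[OF that] by (auto simp: verts_S X1_def)
  show "u \<in> X1 \<Longrightarrow> theta S a (\<phi> u) = (if u \<in> A1 then 1 else -1)"
    using u theta_S_sym[of a "\<phi> u"] theta_\<phi>_a[of u] markers_in_S by (auto simp: X1_def)
  show "u \<in> X1 \<Longrightarrow> theta S b (\<phi> u) = (if u \<in> B1 then 1 else -1)"
    using u theta_S_sym[of b "\<phi> u"] theta_\<phi>_b[of u] markers_in_S by (auto simp: X1_def)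
  show "\<not> od \<Longrightarrow> u \<in> X1 \<Longrightarrow> theta S c (\<phi> u) = -1"
    using u theta_S_sym[of c "\<phi> u"] theta_\<phi>_c[of u] markers_in_S by (auto simp: X1_def)
  show "theta S b a = (if od then 0 else -1)" "\<not> od \<Longrightarrow> theta S c a = 0" "\<not> od \<Longrightarrow> theta S c b = 0"
    using theta_S_sym[of a b] theta_S_sym[of a c] theta_S_sym[of b c] markers_in_S markers_distinct
      theta_a_b theta_a_c theta_b_c by auto
qed

lemma strongly_adjacent_marker:
  "strongly_adjacent S a x \<Longrightarrow> \<exists>u\<in>A1. x = \<phi> u"
  "strongly_adjacent S b x \<Longrightarrow> \<exists>u\<in>B1. x = \<phi> u"
  "\<not> od \<Longrightarrow> \<not> strongly_adjacent S c x"
proof -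
  have x: "x \<in> verts S" "m \<noteq> x" "theta S m x = 1" if "strongly_adjacent S m x" for m
    using that by (auto simp: strongly_adjacent_def)
  show "\<exists>u\<in>A1. x = \<phi> u" if "strongly_adjacent S a x"
    using x(1)[OF that] x(2,3)[OF that]
    by (cases rule: verts_S_cases) (auto simp: theta_marker theta_a_b theta_a_c split: if_splits)
  show "\<exists>u\<in>B1. x = \<phi> u" if "strongly_adjacent S b x"
    using x(1)[OF that] x(2,3)[OF that]
    by (cases rule: verts_S_cases) (auto simp: theta_marker theta_b_c split: if_splits)
  show "\<not> strongly_adjacent S c x" if "\<not> od"
  proof
    assume "strongly_adjacent S c x"
    from x[OF this] show False using that
      by (cases rule: verts_S_cases) (auto simp: theta_marker)
  qed
qed

lemma strongly_adjacent_sym: "strongly_adjacent S x y \<Longrightarrow> strongly_adjacent S y x"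
  unfolding strongly_adjacent_def using theta_S_sym[of x y] by auto

lemma markers_notin_B:
  assumes "skew_partition S A' B'"
  shows "c \<notin> B'" "a \<notin> B' \<or> b \<notin> B'"
proof -
  obtain Y Z where YZ: "Y \<noteq> {}" "Z \<noteq> {}" "Y \<union> Z = B'" "Y \<inter> Z = {}"
      "\<And>y z. y \<in> Y \<Longrightarrow> z \<in> Z \<Longrightarrow> strongly_adjacent S y z"
    using assms unfolding skew_partition_def not_tri_anticonnected_iff by metis
  have B': "B' \<subseteq> verts S" using assms by (auto simp: skew_partition_def)
  show "c \<notin> B'"
  proof
    assume c: "c \<in> B'"
    then have "c \<in> verts S" using B' by blast
    then have od: "\<not> od" using markers_new(3) markers_distinct by (auto simp: verts_S split: if_splits)
    obtain y z where "y \<in> Y" "z \<in> Z" using YZ by blast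
    then have "strongly_adjacent S c z \<or> strongly_adjacent S c y"
      using c YZ(3,5) strongly_adjacent_sym by blast
    then show False using strongly_adjacent_marker(3)[OF od] by blast
  qed
  have False if ab: "a \<in> B'" "b \<in> B'"
  proof -
    have "\<not> strongly_adjacent S a b" "\<not> strongly_adjacent S b a"
      using markers_new theta_a_b theta_marker(4) by (auto simp: strongly_adjacent_def split: if_splits)
    \<comment> \<open>Not being strongly adjacent, \<open>a\<close> and \<open>b\<close> share a
      part, so a vertex of the other part is strongly adjacent to both and would come from
      \<open>A1\<close> and \<open>B1\<close> at once.\<close>
    then have "a \<in> Y \<and> b \<in> Y \<or> a \<in> Z \<and> b \<in> Z" using ab YZ(3,5) by blast
    then obtain x where "strongly_adjacent S a x" "strongly_adjacent S b x"
      using YZ(1,2,5) strongly_adjacent_sym by blast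
    then obtain u v where "u \<in> A1" "v \<in> B1" "\<phi> u = \<phi> v" using strongly_adjacent_marker by metis
    then show False using inj_onD[OF inj_\<phi>, of u v] X_facts(7) by blast
  qed
  then show "a \<notin> B' \<or> b \<notin> B'" by blast
qed

text \<open>The disconnected side is \<open>verts T - B\<close> and not the preimage of
  \<open>A'\<close>, because in the odd case \<open>C2\<close> is mapped outside
  \<open>verts S\<close>.\<close>

lemma skew_partition_pullback:
  assumes sk: "skew_partition S A' B'" and a: "a \<notin> B'"
  defines "B \<equiv> {u \<in> verts T. \<phi> u \<in> B'}"
  shows "skew_partition T (verts T - B) B"
proof -
  have c: "c \<notin> B'" by (rule markers_notin_B(1)[OF sk])
  have AB: "A' \<union> B' = verts S" "A' \<inter> B' = {}" using sk by (auto simp: skew_partition_def)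
  obtain Y Z where YZ: "Y \<noteq> {}" "Z \<noteq> {}" "Y \<union> Z = B'" "Y \<inter> Z = {}"
      "\<And>y z. y \<in> Y \<Longrightarrow> z \<in> Z \<Longrightarrow> strongly_adjacent S y z"
    using sk unfolding skew_partition_def not_tri_anticonnected_iff by metis
  \<comment> \<open>\<open>C2\<close> may be empty, so \<open>c\<close> is the one vertex that may
    lack a preimage.\<close>
  have preimage: "\<exists>u\<in>verts T. x = \<phi> u" if "x \<in> verts S" "x \<noteq> c" for x
    using that(1)
  proof (cases rule: verts_S_cases)
    case (1 u) then show ?thesis using verts_T_iff by blast
  next
    case 2 then show ?thesis using nonempty2 \<phi>_2 verts_T_iff X_facts(3) by (metis ex_in_conv)
  next
    case 3 then show ?thesis using nonempty2 \<phi>_2 verts_T_iff X_facts(4) by (metis ex_in_conv)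
  qed (use that in blast)
  let ?inv = "\<lambda>U. {u \<in> verts T. \<phi> u \<in> U}"
  have ne: "?inv U \<noteq> {}" if "U \<noteq> {}" "U \<subseteq> verts S" "c \<notin> U" for U
    using that preimage by blast
  have "\<not> tri_anticonnected T B"
    unfolding not_tri_anticonnected_iff
  proof (intro exI conjI)
    show "?inv Y \<noteq> {}" "?inv Z \<noteq> {}" using ne[of Y] ne[of Z] YZ(1-3) AB(1) c by blast+
    show "?inv Y \<union> ?inv Z = B" "?inv Y \<inter> ?inv Z = {}" using YZ(3,4) by (auto simp: B_def)
    show "\<forall>y\<in>?inv Y. \<forall>z\<in>?inv Z. strongly_adjacent T y z"
      using YZ(5) strongly_adjacent_\<phi>_D by simp
  qed
  moreover have "\<not> tri_connected T (verts T - B)"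
  proof -
    have adj_sym: "adjacent S x y \<Longrightarrow> adjacent S y x" for x y by (rule adjacent_sym[OF wf_S])
    have "\<exists>V W. V \<noteq> {} \<and> W \<noteq> {} \<and> V \<union> W = A' \<and> V \<inter> W = {} \<and>
        (\<forall>y\<in>V. \<forall>z\<in>W. \<not> adjacent S y z)"
      using sk unfolding skew_partition_def not_tri_connected_iff by blast
    moreover have "a \<in> A'" using AB a markers_in_S by blast
    ultimately obtain V W where VW: "W \<noteq> {}" "V \<union> W = A'" "V \<inter> W = {}" "a \<in> V"
      "\<And>y z. y \<in> V \<Longrightarrow> z \<in> W \<Longrightarrow> \<not> adjacent S y z"
      by (metis Int_commute Un_commute Un_iff adj_sym)
    \<comment> \<open>The markers in \<open>A'\<close> hang together through switchable pairs, so
      all lie in \<open>V\<close> with \<open>a\<close>, and \<open>W\<close> comes from the first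
      side.\<close>
    have cW: "c \<notin> W"
    proof
      assume "c \<in> W"
      then have "c \<in> verts S" using VW AB by blast
      then have od: "\<not> od" using markers_new(3) markers_distinct by (auto simp: verts_S split: if_splits)
      then have "adjacent S a c"
        using markers_in_S markers_distinct theta_a_c by (simp add: adjacent_def)
      then show False using VW(4,5) \<open>c \<in> W\<close> by blast
    qed
    have bW: "b \<notin> W"
    proof
      assume b: "b \<in> W"
      show False
      proof (cases od)
        case True
        then have "adjacent S a b"
          using markers_in_S markers_distinct theta_a_b by (simp add: adjacent_def)
        then show False using VW(4,5) b by blast
      next
        case False
        then have "adjacent S c b"
          using markers_in_S markers_distinct theta_marker(6) by (simp add: adjacent_def)
        moreover have "c \<in> V" using VW(2) AB cW c markers_in_S(3)[OF False] by blast
        ultimately show False using VW(5) b by blast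
      qed
    qed
    let ?W = "?inv W"
    have W_X1: "u \<in> X1" if "u \<in> ?W" for u
      using that cW bW VW(3,4) \<phi>_2 unfolding verts_T_iff X2_iff by auto
    have WB: "?W \<subseteq> verts T - B" using VW(2) AB(2) by (auto simp: B_def)
    obtain u0 where u0: "u0 \<in> A2" using nonempty2 by blast
    then have "u0 \<in> verts T" "\<phi> u0 = a" using X_facts verts_T_iff \<phi>_2 by auto
    then have u0V: "u0 \<in> verts T - B - ?W" using a VW(3,4) by (auto simp: B_def)
    have "\<not> adjacent T u w" if u: "u \<in> verts T - B - ?W" and w: "w \<in> ?W" for u w
    proof
      assume uw: "adjacent T u w"
      have wX: "w \<in> X1" by (rule W_X1[OF w])
      \<comment> \<open>A neighbour of \<open>X1\<close> lies outside \<open>C2\<close>, so its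
        image is a vertex of \<open>S\<close> also in the odd case.\<close>
      have uC: "u \<notin> C2"
        using uw cross(3)[OF wX, of u] joined_X2[of w u] X_facts by blast
      have "adjacent S (\<phi> u) (\<phi> w)"
        using \<phi>_adjacent[OF uw] wX uC X_facts by blast
      moreover have "\<phi> u \<in> V"
      proof -
        have "\<phi> u \<in> verts S" using \<phi>_in_verts u uC by blast
        then show ?thesis using u VW(2) AB by (auto simp: B_def)
      qed
      ultimately show False using VW(5) w by blast
    qed
    moreover have "?W \<noteq> {}" using ne[of W] VW(1,2) AB(1) cW by blast
    moreover have "(verts T - B - ?W) \<union> ?W = verts T - B" "(verts T - B - ?W) \<inter> ?W = {}"
      using WB by auto
    moreover have "verts T - B - ?W \<noteq> {}" using u0V by blast
    ultimately show ?thesis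
      unfolding not_tri_connected_iff
      by (intro exI[of _ "verts T - B - ?W"] exI[of _ ?W] conjI ballI)
  qed
  ultimately show ?thesis by (auto simp: skew_partition_def B_def)
qed

lemma balanced_skew_partition_pullback:
  assumes bal: "balanced_skew_partition S A' B'" and a: "a \<notin> B'"
  shows "has_balanced_skew_partition T"
proof -
  have sk: "skew_partition S A' B'" using bal by (simp add: balanced_skew_partition_def)
  have c: "c \<notin> B'" by (rule markers_notin_B(1)[OF sk])
  have AB: "A' \<union> B' = verts S" "A' \<inter> B' = {}" using sk by (auto simp: skew_partition_def)
  have path_A': "x \<in> A'" if "is_path S q \<or> is_antipath S q" "x \<in> set q" "x \<notin> B'" for x q
    using that AB(1) unfolding is_antipath_def is_path_def by auto
  have int_set: "path_interior q \<subseteq> set q" for q :: "'b list"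
    by (cases q) (auto simp: path_interior_def dest: in_set_butlastD)
  have noP: False if "is_path S q" "even (length q)" "4 \<le> length q" "hd q \<in> B'" "last q \<in> B'"
    "path_interior q \<inter> B' = {}" for q
  proof -
    have "path_interior q \<subseteq> A'" using path_A' that(1,6) int_set by blast
    moreover have "odd (path_length q)" "path_length q > 1"
      using odd_path_length_iff[of q] that(2,3) by auto
    ultimately show False using bal that unfolding balanced_skew_partition_def by blast
  qed
  have noA: False if "is_antipath S q" "even (length q)" "4 \<le> length q" "hd q \<notin> B'" "last q \<notin> B'"
    "path_interior q \<subseteq> B'" for q
  proof -
    have "q \<noteq> []" using that(3) by auto
    then have "hd q \<in> A'" "last q \<in> A'" using path_A'[of q] that by auto
    moreover have "odd (path_length q)" "path_length q > 1"
      using odd_path_length_iff[of q] that(2,3) by auto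
    ultimately show False using bal that unfolding balanced_skew_partition_def by blast
  qed
  define B where "B = {u \<in> verts T. \<phi> u \<in> B'}"
  have "skew_partition T (verts T - B) B"
    unfolding B_def by (rule skew_partition_pullback[OF sk a])
  moreover have False
    if p: "is_path T p" "odd (path_length p)" "path_length p > 1" "hd p \<in> B" "last p \<in> B"
      "path_interior p \<subseteq> verts T - B" for p
  proof -
    have l: "even (length p)" "4 \<le> length p" "p \<noteq> []" using odd_path_length_iff[of p] p(2,3) by auto
    show False
    proof (rule no_odd_path[OF noP a c p(1) l(1,2)])
      show "\<phi> (p ! 0) \<in> B'" "\<phi> (p ! (length p - 1)) \<in> B'"
        using p(4,5) l(3) by (auto simp: B_def hd_conv_nth last_conv_nth)
      show "\<phi> (p ! i) \<notin> B'" if "0 < i" "i < length p - 1" for i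
        using path_interior_nth[OF that] p(6) by (auto simp: B_def)
    qed
  qed
  moreover have False
    if p: "is_antipath T p" "odd (path_length p)" "path_length p > 1" "hd p \<in> verts T - B"
      "last p \<in> verts T - B" "path_interior p \<subseteq> B" for p
  proof -
    have l: "even (length p)" "4 \<le> length p" "p \<noteq> []" using odd_path_length_iff[of p] p(2,3) by auto
    show False
    proof (rule no_odd_antipath[OF noA a c p(1) l(1,2)])
      show "\<phi> (p ! 0) \<notin> B'" "\<phi> (p ! (length p - 1)) \<notin> B'"
        using p(4,5) l(3) by (auto simp: B_def hd_conv_nth last_conv_nth)
      show "\<phi> (p ! i) \<in> B'" if "0 < i" "i < length p - 1" for i
        using path_interior_nth[OF that] p(6) by (auto simp: B_def)
    qed
  qed
  ultimately have "balanced_skew_partition T (verts T - B) B"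
    unfolding balanced_skew_partition_def by blast
  then show ?thesis by (auto simp: has_balanced_skew_partition_def)
qed

lemma has_balanced_skew_partition_pullback:
  assumes "has_balanced_skew_partition S"
  shows "has_balanced_skew_partition T"
proof -
  obtain A' B' where bal: "balanced_skew_partition S A' B'"
    using assms by (auto simp: has_balanced_skew_partition_def)
  then have "a \<notin> B' \<or> b \<notin> B'"
    using markers_notin_B(2) unfolding balanced_skew_partition_def by blast
  then show ?thesis
    using balanced_skew_partition_pullback[OF bal]
      two_join_block.balanced_skew_partition_pullback[OF swap bal] by blast
qed

end


section \<open>The four blocks\<close>

text \<open>One verification for all four blocks: \<open>S\<close> is described by values of
  \<open>theta\<close> only, so it may be a block or the complement of a complement block. The
  condition \<open>m \<noteq> n\<close> leaves out the diagonal, whose value differs between the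
  two.\<close>

lemma marker_two_join_block:
  fixes S :: "('a + marker) trigraph"
  assumes wf: "wf_trigraph T" and berge: "berge T" and tj: "two_join T A1 B1 C1 A2 B2 C2"
    and parity: "\<And>p. side_path T A2 B2 C2 p \<Longrightarrow> odd (path_length p) \<longleftrightarrow> od"
    and M: "M = {Marker_a, Marker_b} \<union> (if od then {} else {Marker_c})"
    and S: "verts S = Inl ` (A1 \<union> B1 \<union> C1) \<union> Inr ` M"
      "\<And>u v. theta S (Inl u) (Inl v) = theta T u v"
      "\<And>u m. u \<in> A1 \<union> B1 \<union> C1 \<Longrightarrow> m \<in> M \<Longrightarrow> theta S (Inl u) (Inr m) =
         (if u \<in> (case m of Marker_a \<Rightarrow> A1 | Marker_b \<Rightarrow> B1 | Marker_c \<Rightarrow> {}) then 1 else -1)"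
      "\<And>u m. theta S (Inr m) (Inl u) = theta S (Inl u) (Inr m)"
      "\<And>m n. m \<in> M \<Longrightarrow> n \<in> M \<Longrightarrow> m \<noteq> n \<Longrightarrow> theta S (Inr m) (Inr n) =
         (if {m, n} = {Marker_a, Marker_b} \<and> \<not> od then -1 else 0)"
  shows "two_join_block T A1 B1 C1 A2 B2 C2 S
     (\<lambda>u. if u \<in> A2 then Inr Marker_a else if u \<in> B2 then Inr Marker_b
          else if u \<in> C2 then Inr Marker_c else Inl u)
     (Inr Marker_a) (Inr Marker_b) (Inr Marker_c) od"
proof -
  have J: "(A1 \<union> B1 \<union> C1) \<union> (A2 \<union> B2 \<union> C2) = verts T" "(A1 \<union> B1 \<union> C1) \<inter> (A2 \<union> B2 \<union> C2) = {}"
      "A1 \<inter> B1 = {}" "A1 \<inter> C1 = {}" "B1 \<inter> C1 = {}" "A2 \<inter> B2 = {}" "A2 \<inter> C2 = {}" "B2 \<inter> C2 = {}"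
      "strongly_complete T A1 A2" "strongly_complete T B1 B2"
      "\<forall>u\<in>A1 \<union> B1 \<union> C1. \<forall>v\<in>A2 \<union> B2 \<union> C2. \<not> (u \<in> A1 \<and> v \<in> A2) \<and> \<not> (u \<in> B1 \<and> v \<in> B2) \<longrightarrow>
         strongly_antiadjacent T u v"
      "good_side T A1 B1 C1" "good_side T A2 B2 C2"
    using tj unfolding two_join_def Let_def by - (elim conjE, assumption)+
  let ?X = "A1 \<union> B1 \<union> C1"
  let ?f = "\<lambda>u. if u \<in> A2 then Inr Marker_a else if u \<in> B2 then Inr Marker_b
          else if u \<in> C2 then Inr Marker_c else Inl u"
  have f: "?f u = Inl u" if "u \<in> ?X" for u using that J(2) by auto
  have f_image: "?f ` ?X = Inl ` ?X" by (rule image_cong[OF refl f])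
  have Mab: "Marker_a \<in> M" "Marker_b \<in> M" "\<not> od \<Longrightarrow> Marker_c \<in> M" by (auto simp: M)
  have theta_T: "theta T u v \<in> {-1, 0, 1} \<and> theta T u v = theta T v u"
    if "u \<in> ?X" "v \<in> ?X" "u \<noteq> v" for u v
    using wf that J(1) unfolding wf_trigraph_def by blast
  have wf_S: "wf_trigraph S"
    unfolding wf_trigraph_def
  proof (intro conjI ballI impI)
    have "finite (verts T)" using wf by (simp add: wf_trigraph_def)
    then have "finite ?X" using J(1) by (metis finite_Un)
    then show "finite (verts S)" by (simp add: S(1) M)
  next
    fix x y assume xy: "x \<in> verts S" "y \<in> verts S" "x \<noteq> y"
    consider u v where "x = Inl u" "y = Inl v" "u \<in> ?X" "v \<in> ?X"
      | u m where "x = Inl u" "y = Inr m" "u \<in> ?X" "m \<in> M"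
      | m u where "x = Inr m" "y = Inl u" "u \<in> ?X" "m \<in> M"
      | m n where "x = Inr m" "y = Inr n" "m \<in> M" "n \<in> M"
      using xy(1,2) unfolding S(1) by blast
    then have "theta S x y \<in> {-1, 0, 1} \<and> theta S x y = theta S y x"
    proof cases
      case 1
      then show ?thesis using theta_T[OF 1(3,4)] xy(3) S(2) by metis
    next
      case 4
      then show ?thesis using S(5)[of m n] S(5)[of n m] xy(3) by (simp add: insert_commute)
    qed (simp_all add: S(3,4))
    then show "theta S x y \<in> {-1, 0, 1}" "theta S x y = theta S y x" by auto
  qed
  show ?thesis
  proof (rule two_join_block.intro)
    show "verts T = ?X \<union> (A2 \<union> B2 \<union> C2)" using J(1) by simp
    show "A1 \<noteq> {}" "B1 \<noteq> {}" "A2 \<noteq> {}" "B2 \<noteq> {}" using J(12,13) by (auto simp: good_side_def)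
    show "theta T u v = (if u \<in> A1 \<and> v \<in> A2 \<or> u \<in> B1 \<and> v \<in> B2 then 1 else -1)"
      if "u \<in> ?X" "v \<in> A2 \<union> B2 \<union> C2" for u v
    proof (cases "u \<in> A1 \<and> v \<in> A2 \<or> u \<in> B1 \<and> v \<in> B2")
      case True
      then have "strongly_adjacent T u v" using J(9,10) unfolding strongly_complete_def by blast
      then show ?thesis using True by (simp add: strongly_adjacent_def)
    next
      case False
      then have "strongly_antiadjacent T u v" using J(11) that by blast
      then show ?thesis using False by (simp only: strongly_antiadjacent_def if_False)
    qed
    show "verts S = ?f ` ?X \<union> {Inr Marker_a, Inr Marker_b} \<union> (if od then {} else {Inr Marker_c})"
      unfolding f_image S(1) M by auto
    show "inj_on ?f ?X" using f by (intro inj_onI) (metis sum.inject(1))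
    show "Inr Marker_a \<notin> ?f ` ?X" "Inr Marker_b \<notin> ?f ` ?X" "Inr Marker_c \<notin> ?f ` ?X"
      unfolding f_image by auto
    show "theta S (?f u) (?f v) = theta T u v" if "u \<in> ?X" "v \<in> ?X" "u \<noteq> v" for u v
      unfolding f[OF that(1)] f[OF that(2)] by (rule S(2))
    show "theta S (?f u) (Inr Marker_a) = (if u \<in> A1 then 1 else -1)" if "u \<in> ?X" for u
      unfolding f[OF that] using S(3)[OF that Mab(1)] by simp
    show "theta S (?f u) (Inr Marker_b) = (if u \<in> B1 then 1 else -1)" if "u \<in> ?X" for u
      unfolding f[OF that] using S(3)[OF that Mab(2)] by simp
    show "theta S (?f u) (Inr Marker_c) = -1" if "\<not> od" "u \<in> ?X" for u
      unfolding f[OF that(2)] using S(3)[OF that(2) Mab(3)[OF that(1)]] by simp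
    show "theta S (Inr Marker_a) (Inr Marker_b) = (if od then 0 else -1)"
      using S(5)[OF Mab(1,2)] by simp
    show "theta S (Inr Marker_a) (Inr Marker_c) = 0" "theta S (Inr Marker_b) (Inr Marker_c) = 0"
      if "\<not> od" using S(5)[OF Mab(1) Mab(3)[OF that]] S(5)[OF Mab(2) Mab(3)[OF that]]
      by (auto simp: doubleton_eq_iff)
  qed (use J wf berge wf_S parity in auto)
qed

lemma block_two_join_block:
  assumes "wf_trigraph T" "berge T" "two_join T A1 B1 C1 A2 B2 C2"
  shows "odd_join T A1 B1 C1 A2 B2 C2 \<Longrightarrow> \<exists>\<phi>. two_join_block T A1 B1 C1 A2 B2 C2
      (odd_block T A1 B1 C1) \<phi> (Inr Marker_a) (Inr Marker_b) (Inr Marker_c) True"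
    and "even_join T A1 B1 C1 A2 B2 C2 \<Longrightarrow> \<exists>\<phi>. two_join_block T A1 B1 C1 A2 B2 C2
      (even_block T A1 B1 C1) \<phi> (Inr Marker_a) (Inr Marker_b) (Inr Marker_c) False"
  by (intro exI, rule marker_two_join_block[OF assms _ refl];
      auto simp: odd_join_def even_join_def odd_block_def even_block_def add_markers_def doubleton_eq_iff)+

text \<open>In the complement, a marker with strong neighbours \<open>B1 \<union> C1\<close> in the
  first side becomes strongly complete to exactly \<open>A1\<close>. This rests on disjointness of
  the three sets, whence \<open>disj\<close>.\<close>

lemma complement_block_two_join_block:
  assumes "wf_trigraph T" "berge T" and tj: "two_join (tri_complement T) A1 B1 C1 A2 B2 C2"
  shows "odd_join (tri_complement T) A1 B1 C1 A2 B2 C2 \<Longrightarrow>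
      \<exists>\<phi>. two_join_block (tri_complement T) A1 B1 C1 A2 B2 C2
      (tri_complement (odd_complement_block T A1 B1 C1)) \<phi> (Inr Marker_a) (Inr Marker_b) (Inr Marker_c) True"
    and "even_join (tri_complement T) A1 B1 C1 A2 B2 C2 \<Longrightarrow>
      \<exists>\<phi>. two_join_block (tri_complement T) A1 B1 C1 A2 B2 C2
      (tri_complement (even_complement_block T A1 B1 C1)) \<phi> (Inr Marker_a) (Inr Marker_b) (Inr Marker_c) False"
proof -
  have disj: "A1 \<inter> B1 = {}" "A1 \<inter> C1 = {}" "B1 \<inter> C1 = {}"
    using tj unfolding two_join_def Let_def by - (elim conjE, assumption)+
  note prems = wf_trigraph_tri_complement[OF assms(1)] berge_tri_complement[OF assms(2)] tj
  show "odd_join (tri_complement T) A1 B1 C1 A2 B2 C2 \<Longrightarrow>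
      \<exists>\<phi>. two_join_block (tri_complement T) A1 B1 C1 A2 B2 C2
      (tri_complement (odd_complement_block T A1 B1 C1)) \<phi> (Inr Marker_a) (Inr Marker_b) (Inr Marker_c) True"
    by (intro exI, rule marker_two_join_block[OF prems _ refl])
      (use disj in \<open>auto simp: odd_join_def odd_complement_block_def add_markers_def
        tri_complement_def doubleton_eq_iff\<close>)
  show "even_join (tri_complement T) A1 B1 C1 A2 B2 C2 \<Longrightarrow>
      \<exists>\<phi>. two_join_block (tri_complement T) A1 B1 C1 A2 B2 C2
      (tri_complement (even_complement_block T A1 B1 C1)) \<phi> (Inr Marker_a) (Inr Marker_b) (Inr Marker_c) False"
    by (intro exI, rule marker_two_join_block[OF prems _ refl])
      (use disj in \<open>auto simp: even_join_def even_complement_block_def add_markers_def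
        tri_complement_def doubleton_eq_iff\<close>)
qed

theorem theorem4p2:
  fixes T :: "'a trigraph" and X :: "'a set" and TX :: "('a + marker) trigraph"
  assumes "T \<in> class_F"
    and "\<not> has_balanced_skew_partition T"
    and "fragment T X"
    and "is_block T X TX"
  shows "\<not> has_balanced_skew_partition TX"
proof
  assume bal: "has_balanced_skew_partition TX"
  have T: "wf_trigraph T" "berge T" using assms(1) by (auto simp: class_F_def)
  obtain A1 B1 C1 A2 B2 C2 where
    "proper_two_join T A1 B1 C1 A2 B2 C2 \<and>
       (odd_join T A1 B1 C1 A2 B2 C2 \<and> TX = odd_block T A1 B1 C1 \<or>
        even_join T A1 B1 C1 A2 B2 C2 \<and> TX = even_block T A1 B1 C1) \<or>
     proper_complement_two_join T A1 B1 C1 A2 B2 C2 \<and>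
       (odd_join (tri_complement T) A1 B1 C1 A2 B2 C2 \<and> TX = odd_complement_block T A1 B1 C1 \<or>
        even_join (tri_complement T) A1 B1 C1 A2 B2 C2 \<and> TX = even_complement_block T A1 B1 C1)"
    using assms(4) unfolding is_block_def by blast
  then show False
  proof
    assume "proper_two_join T A1 B1 C1 A2 B2 C2 \<and>
       (odd_join T A1 B1 C1 A2 B2 C2 \<and> TX = odd_block T A1 B1 C1 \<or>
        even_join T A1 B1 C1 A2 B2 C2 \<and> TX = even_block T A1 B1 C1)"
    then obtain \<phi> od where blk: "two_join_block T A1 B1 C1 A2 B2 C2 TX \<phi>
        (Inr Marker_a) (Inr Marker_b) (Inr Marker_c) od"
      using block_two_join_block[OF T] unfolding proper_two_join_def by blast
    have "has_balanced_skew_partition T"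
      by (rule two_join_block.has_balanced_skew_partition_pullback[OF blk bal])
    then show False using assms(2) by blast
  next
    assume "proper_complement_two_join T A1 B1 C1 A2 B2 C2 \<and>
       (odd_join (tri_complement T) A1 B1 C1 A2 B2 C2 \<and> TX = odd_complement_block T A1 B1 C1 \<or>
        even_join (tri_complement T) A1 B1 C1 A2 B2 C2 \<and> TX = even_complement_block T A1 B1 C1)"
    then obtain \<phi> od where blk: "two_join_block (tri_complement T) A1 B1 C1 A2 B2 C2
        (tri_complement TX) \<phi> (Inr Marker_a) (Inr Marker_b) (Inr Marker_c) od"
      using complement_block_two_join_block[OF T]
      unfolding proper_complement_two_join_def proper_two_join_def by blast
    \<comment> \<open>The locale instance asserts well-formedness of the complement of
      \<open>TX\<close>; complementing once more gives it for \<open>TX\<close>.\<close>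
    have "wf_trigraph TX"
      using wf_trigraph_tri_complement[OF two_join_block.wf_S[OF blk]]
      by (simp only: tri_complement_involution)
    then have "has_balanced_skew_partition (tri_complement TX)"
      using has_balanced_skew_partition_tri_complement bal by blast
    then have "has_balanced_skew_partition (tri_complement T)"
      by (rule two_join_block.has_balanced_skew_partition_pullback[OF blk])
    then have "has_balanced_skew_partition (tri_complement (tri_complement T))"
      using has_balanced_skew_partition_tri_complement wf_trigraph_tri_complement[OF T(1)] by blast
    then show False using assms(2) by (simp add: tri_complement_involution)
  qed
qed

end
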